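(* Let $n$ be an odd positive integer with $n>M_1^2$, where $M_1$ is defined in the context. Then for every primitive $n$-th root of unity $\zeta$ we have $\phi(\zeta)\neq 0$, $\mu(\zeta)\ne 0$ and $\sigma(-\zeta)\neq 0$.
   Context: Notation: $(a;q)_0=1$, $(a;q)_k=\prod_{j=0}^{k-1}(1-aq^j)$. A primitive $n$-th root of unity is a complex $\zeta$ with $\zeta^n=1$ and $\zeta^m\ne1$ for $0<m<n$. Ramanujan's sixth order mock theta functions are, for $|q|<1$, $\phi(q)=\sum_{k\ge0}\frac{(-1)^k q^{k^2}(q;q^2)_k}{(-q;q)_{2k}}$, $\mu(q)=\sum_{k\ge0}\frac{(-1)^k (q;q^2)_k}{(-q;q)_k}$, $\sigma(q)=\sum_{k\ge0}\frac{q^{\binom{k+2}{2}}(-q;q)_k}{(q;q^2)_{k+1}}$. If $\zeta$ is a root of unity of odd order, substituting $q=\zeta$ in the series for $\phi$ and $\mu$, and $q=-\zeta$ in the series for $\sigma$, gives series whose denominators are all nonzero and whose terms vanish for all sufficiently large $k$. The values $\phi(\zeta)$, $\mu(\zeta)$, $\sigma(-\zeta)$ denote these finite sums. For a root of unity $\zeta$ of odd order let $M_{1,\zeta}=\sup_{0\le r<1}|\phi(r\zeta)|$, and let $M_1=\inf\{M_{1,\zeta}:\ \zeta \text{ a primitive root of unity of odd order}\}$. *)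

theory Defs
  imports "HOL-Analysis.Analysis"
begin

definition qpoch :: "complex \<Rightarrow> complex \<Rightarrow> nat \<Rightarrow> complex" where
  "qpoch a q k = (\<Prod>j<k. 1 - a * q ^ j)"

definition primitive_root :: "nat \<Rightarrow> complex \<Rightarrow> bool" where
  "primitive_root n \<zeta> \<longleftrightarrow> 0 < n \<and> \<zeta> ^ n = 1 \<and> (\<forall>m. 0 < m \<and> m < n \<longrightarrow> \<zeta> ^ m \<noteq> 1)"

text \<open>
  One \<^const>\<open>suminf\<close> serves both inside the unit disc and at the roots of unity where the series
  terminates; the lemmas at the end of this theory show that at the latter it is the finite sum
  and that no denominator vanishes there. The series for \<open>\<mu>\<close> does not converge in the ordinary
  sense for \<open>|q| < 1\<close> (only its Cesaro means do), so \<open>mock_mu\<close> is meaningful only where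
  the series terminates.
\<close>

definition mock_phi :: "complex \<Rightarrow> complex" where
  "mock_phi q = (\<Sum>k. (-1) ^ k * q ^ (k\<^sup>2) * qpoch q (q\<^sup>2) k / qpoch (-q) q (2 * k))"

definition mock_mu :: "complex \<Rightarrow> complex" where
  "mock_mu q = (\<Sum>k. (-1) ^ k * qpoch q (q\<^sup>2) k / qpoch (-q) q k)"

definition mock_sigma :: "complex \<Rightarrow> complex" where
  "mock_sigma q = (\<Sum>k. q ^ ((k + 2) choose 2) * qpoch (-q) q k / qpoch q (q\<^sup>2) (k + 1))"

text \<open>
  The supremum and infimum are taken in the extended reals, so that no boundedness of
  \<open>|\<phi>|\<close> along the radius is presupposed.
\<close>

definition M1_at :: "complex \<Rightarrow> ereal" where
  "M1_at \<zeta> = (SUP r\<in>{0..<1::real}. ereal (norm (mock_phi (of_real r * \<zeta>))))"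

definition M1 :: ereal where
  "M1 = (INF \<zeta>\<in>{\<zeta>. \<exists>m. odd m \<and> primitive_root m \<zeta>}. M1_at \<zeta>)"

lemma qpoch_eq_0_iff: "qpoch a q k = 0 \<longleftrightarrow> (\<exists>j<k. a * q ^ j = 1)"
  by (auto simp: qpoch_def)

lemma odd_root_power_neq_minus_1:
  assumes "odd n" "primitive_root n \<zeta>"
  shows "\<zeta> ^ i \<noteq> -1"
proof
  assume "\<zeta> ^ i = -1"
  then have "(\<zeta> ^ n) ^ i = (-1) ^ n"
    by (metis power_mult mult.commute)
  then show False
    using assms by (simp add: primitive_root_def)
qed

lemma denominator_nonzero:
  assumes "odd n" "primitive_root n \<zeta>"
  shows "qpoch (-\<zeta>) \<zeta> k \<noteq> 0" "qpoch (-\<zeta>) ((-\<zeta>)\<^sup>2) k \<noteq> 0"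
proof -
  have "-\<zeta> * \<zeta> ^ j \<noteq> 1" for j
    using odd_root_power_neq_minus_1[OF assms, of "Suc j"]
    by (metis minus_minus mult_minus_left power_Suc)
  then show "qpoch (-\<zeta>) \<zeta> k \<noteq> 0"
    by (simp add: qpoch_eq_0_iff)
  have "-\<zeta> * ((-\<zeta>)\<^sup>2) ^ j \<noteq> 1" for j
    using odd_root_power_neq_minus_1[OF assms, of "Suc (2 * j)"]
    by (metis minus_minus mult_minus_left power_Suc power2_minus power_mult)
  then show "qpoch (-\<zeta>) ((-\<zeta>)\<^sup>2) k \<noteq> 0"
    by (simp add: qpoch_eq_0_iff)
qed

lemma numerator_zero:
  assumes "odd n" "primitive_root n \<zeta>" "k \<ge> n"
  shows "qpoch \<zeta> (\<zeta>\<^sup>2) k = 0" "qpoch \<zeta> (-\<zeta>) k = 0"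
proof -
  obtain m where m: "n = Suc (2 * m)"
    using \<open>odd n\<close> by (auto elim: oddE)
  have z: "\<zeta> * \<zeta> ^ (2 * m) = 1"
    using assms m by (simp add: primitive_root_def)
  have "\<zeta> * (\<zeta>\<^sup>2) ^ m = 1" "m < k"
    using z m assms by (simp_all add: power_mult)
  then show "qpoch \<zeta> (\<zeta>\<^sup>2) k = 0"
    unfolding qpoch_eq_0_iff by blast
  have "\<zeta> * (-\<zeta>) ^ (2 * m) = 1" "2 * m < k"
    using z m assms by (simp_all add: power_mult)
  then show "qpoch \<zeta> (-\<zeta>) k = 0"
    unfolding qpoch_eq_0_iff by blast
qed

lemma mock_theta_at_odd_root:
  assumes "odd n" "primitive_root n \<zeta>"
  shows "mock_phi \<zeta> = (\<Sum>k<n. (-1) ^ k * \<zeta> ^ (k\<^sup>2) * qpoch \<zeta> (\<zeta>\<^sup>2) k / qpoch (-\<zeta>) \<zeta> (2 * k))"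
    and "mock_mu \<zeta> = (\<Sum>k<n. (-1) ^ k * qpoch \<zeta> (\<zeta>\<^sup>2) k / qpoch (-\<zeta>) \<zeta> k)"
    and "mock_sigma (-\<zeta>) =
      (\<Sum>k<n. (-\<zeta>) ^ ((k + 2) choose 2) * qpoch \<zeta> (-\<zeta>) k / qpoch (-\<zeta>) ((-\<zeta>)\<^sup>2) (k + 1))"
  unfolding mock_phi_def mock_mu_def mock_sigma_def minus_minus
  by (rule suminf_finite; simp add: numerator_zero[OF assms])+

end

theory Submission
  imports Defs "HOL-Computational_Algebra.Polynomial_Factorial"
begin

text \<open>
  For an odd \<open>n\<close> and a primitive \<open>n\<close>-th root of unity \<open>s\<close> put
  \<open>W n s = (\<Sum>k<n. (-1) ^ k * s ^ (k * (3 * k + 1)))\<close>. Bailey pairs, combined with creative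
  telescoping for the conjugate sequences, show that \<open>\<phi>(\<zeta>) = W n s\<close> where \<open>s\<^sup>2 = 1 / \<zeta>\<close>, and that
  \<open>\<mu>(\<zeta>)\<close> and \<open>\<sigma>(-\<zeta>)\<close> are nonzero multiples of \<open>W n (1 / \<zeta>)\<close>; for the last two the Bailey lemma
  gives an indefinite double sum which becomes a sum over a full period in both variables, and one
  of them then contributes a quadratic Gauss sum.

  It remains to see that \<open>W n s\<close> never vanishes. If it does, then so do all its Galois conjugates.
  Let \<open>p \<ge> 5\<close> be a prime factor of \<open>n\<close>. Since \<open>k (3 k + 1)\<close> misses a residue modulo \<open>p\<close>, a
  combination of the conjugates isolates the terms with \<open>p\<close> dividing \<open>6 k + 1\<close>, and these form
  \<open>W m\<close> with \<open>m = n / p\<close> or \<open>m = n / p\<^sup>2\<close>. One descends to \<open>n = 3 ^ a\<close>, where \<open>W n s\<close> is congruent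
  to \<open>1\<close> modulo \<open>1 - s\<close>, which is not a unit.
\<close>

section \<open>Bailey pairs\<close>

text \<open>At a root of unity the limits of Bailey's lemma are replaced by a vanishing factor at
  the end of the summation range. For \<open>\<mu>\<close> and \<open>\<sigma>\<close> the conjugate
  sequences are determined only up to a constant: ratios of neighbours are telescoped, and the last
  member, a single product, shows that the constant is not zero.

  The obstacle in the descent is the case of \<open>p\<close> not dividing \<open>m = n / p\<close>.
  The numbers \<open>w * \<eta> ^ a\<close> with \<open>w = s ^ p\<close> and
  \<open>\<eta> = s ^ m\<close> are then conjugates of \<open>s\<close> for \<open>0 < a < p\<close>
  only, so a Fourier inversion modulo \<open>p\<close> lacks one value. Subtracting the projection
  to the missed residue, which is zero, makes the coefficient of the unknown value vanish. The
  residue that is kept is the one at the vertex of \<open>k (3 k + 1)\<close>: since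
  \<open>12 k (3 k + 1) + 1 = (6 k + 1)\<^sup>2\<close>, it is attained on a single class of
  \<open>k\<close>.

  Algebraic integers appear only as values of integer polynomials at a root of unity, and each
  contradiction of an arithmetic kind consists in an integer \<open>p > 1\<close> becoming a unit
  among them.\<close>

text \<open>The weight in a Bailey pair relative to \<open>a = 1\<close> (for \<open>s = 0\<close>)
  or \<open>a = q\<close> (for \<open>s = 1\<close>, up to the factor \<open>1 - q\<close>). The
  case distinction keeps truncated subtraction from producing a nonzero value for
  \<open>r > k\<close>.\<close>

definition bailey_kernel :: "nat \<Rightarrow> complex \<Rightarrow> nat \<Rightarrow> nat \<Rightarrow> complex" where
  "bailey_kernel s q k r =
     (if r \<le> k then 1 / (qpoch q q (k - r) * qpoch q q (k + r + s)) else 0)"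

section \<open>Recurrences of the kernel in both indices\<close>

lemma qpoch_0 [simp]: "qpoch a q 0 = 1"
  by (simp add: qpoch_def)

lemma qpoch_Suc: "qpoch a q (Suc k) = qpoch a q k * (1 - a * q ^ k)"
  by (simp add: qpoch_def)

lemma qpoch_self_nonzero:
  assumes "\<And>j. 0 < j \<Longrightarrow> j \<le> k \<Longrightarrow> q ^ j \<noteq> 1"
  shows "qpoch q q k \<noteq> 0"
  using assms[of "Suc j" for j] by (auto simp: qpoch_eq_0_iff Suc_le_eq)

lemma bailey_kernel_beyond [simp]: "k < r \<Longrightarrow> bailey_kernel s q k r = 0"
  by (simp add: bailey_kernel_def)

lemma bailey_kernel_Suc_right_aux:
  assumes "\<And>j. 0 < j \<Longrightarrow> j \<le> 2 * k + s \<Longrightarrow> q ^ j \<noteq> 1" and "r \<le> k"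
  shows "bailey_kernel s q k (Suc r) * (1 - q ^ (k + r + s + 1)) =
         bailey_kernel s q k r * (1 - q ^ (k - r))"
proof (cases "r = k")
  case False
  then obtain d where d: "k = r + Suc d"
    using assms(2) by (metis less_iff_Suc_add nat_less_le add_Suc_right)
  have "q ^ Suc d \<noteq> 1" "q ^ (k + r + s + 1) \<noteq> 1"
    using assms(1)[of "Suc d"] assms(1)[of "k + r + s + 1"] d by auto
  moreover have "qpoch q q (k + Suc r + s) = qpoch q q (k + r + s) * (1 - q ^ (k + r + s + 1))"
    by (simp add: qpoch_Suc)
  moreover have "qpoch q q (k - r) = qpoch q q (k - Suc r) * (1 - q ^ (k - r))"
    by (simp add: d qpoch_Suc)
  ultimately show ?thesis
    using d by (simp add: bailey_kernel_def)
qed simp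

lemma bailey_kernel_pred_left_aux:
  assumes "\<And>j. 0 < j \<Longrightarrow> j \<le> 2 * Suc k + s \<Longrightarrow> q ^ j \<noteq> 1"
  shows "bailey_kernel s q k r =
         bailey_kernel s q (Suc k) r * (1 - q ^ (Suc k - r)) * (1 - q ^ (Suc k + r + s))"
proof (cases "r \<le> k")
  case True
  then have nz: "q ^ (Suc k - r) \<noteq> 1" "q ^ (Suc k + r + s) \<noteq> 1"
    using assms[of "Suc k - r"] assms[of "Suc k + r + s"] by auto
  have "qpoch q q (Suc k + r + s) = qpoch q q (k + r + s) * (1 - q ^ (Suc k + r + s))"
    by (simp add: qpoch_Suc)
  moreover have "qpoch q q (Suc k - r) = qpoch q q (k - r) * (1 - q ^ (Suc k - r))"
    using True by (simp add: qpoch_Suc Suc_diff_le)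
  ultimately show ?thesis
    using True nz by (simp add: bailey_kernel_def del: power_Suc add_Suc)
next
  case False
  then show ?thesis by simp
qed


text \<open>Exponents become quotients and products, so that in \<open>X = q ^ k\<close> and
  \<open>Y = q ^ r\<close> the later telescoping identities are identities of rational
  functions.\<close>

lemma bailey_kernel_Suc_right:
  assumes "\<And>j. 0 < j \<Longrightarrow> j \<le> 2 * k + s \<Longrightarrow> q ^ j \<noteq> 1" and "r \<le> k" and "q \<noteq> 0"
  shows "bailey_kernel s q k (Suc r) * (1 - q ^ k * q ^ r * q ^ Suc s) =
         bailey_kernel s q k r * (1 - q ^ k / q ^ r)"
  using bailey_kernel_Suc_right_aux[of k s q r] assms by (simp add: power_diff power_add mult_ac)

lemma bailey_kernel_pred_left:
  assumes "\<And>j. 0 < j \<Longrightarrow> j \<le> 2 * Suc k + s \<Longrightarrow> q ^ j \<noteq> 1" and "q \<noteq> 0"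
  shows "bailey_kernel s q k r =
         bailey_kernel s q (Suc k) r * (1 - q ^ Suc k / q ^ r) * (1 - q ^ Suc k * q ^ r * q ^ s)"
proof (cases "r \<le> Suc k")
  case True
  then have "q ^ (Suc k - r) = q ^ Suc k / q ^ r"
    using assms(2) by (simp add: power_diff del: power_Suc)
  moreover have "q ^ (Suc k + r + s) = q ^ Suc k * q ^ r * q ^ s"
    by (simp add: power_add)
  ultimately show ?thesis
    using bailey_kernel_pred_left_aux[of k s q r] assms(1) by metis
qed simp

lemma pentagonal_Suc: "Suc r * (3 * Suc r + 1) div 2 = r * (3 * r + 1) div 2 + 3 * r + 2"
proof -
  have "Suc r * (3 * Suc r + 1) = r * (3 * r + 1) + 2 * (3 * r + 2)"
    by (simp add: algebra_simps)
  then show ?thesis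
    by simp
qed

lemma triangular_Suc: "Suc r * Suc (Suc r) div 2 = r * Suc r div 2 + Suc r"
proof -
  have "Suc r * Suc (Suc r) = r * Suc r + 2 * Suc r"
    by (simp add: algebra_simps)
  then show ?thesis
    by simp
qed

lemma pentagonal_eq_square_plus_triangular: "r * (3 * r + 1) div 2 = r\<^sup>2 + r * Suc r div 2"
proof -
  have "r * (3 * r + 1) = 2 * r\<^sup>2 + r * Suc r"
    by (simp add: algebra_simps power2_eq_square)
  then show ?thesis
    by simp
qed

lemma mult_eq_inverseD:
  fixes x s p :: complex
  assumes "x * s = 1 / p" "x \<noteq> 0"
  shows "s = 1 / (p * x)"
  using assms by (metis divide_divide_eq_left nonzero_mult_div_cancel_left)

text \<open>The sum of \<open>(-1) ^ j * q ^ (- j\<^sup>2)\<close> over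
  \<open>- r \<le> j \<le> r\<close>, folded at \<open>j = 0\<close> to stay within natural
  exponents.\<close>

definition theta_partial :: "complex \<Rightarrow> nat \<Rightarrow> complex" where
  "theta_partial q r = 1 + 2 * (\<Sum>j<r. (-1) ^ Suc j / q ^ ((Suc j)\<^sup>2))"

text \<open>
  The partial sums in the recurrences for the three Bailey pairs have closed forms; the next three
  identities are their induction steps, with \<open>X = q ^ k\<close>, \<open>Y = q ^ r\<close> and \<open>E\<close>, \<open>E1\<close>, \<open>E2\<close> the
  kernel at \<open>r\<close>, \<open>r + 1\<close>, \<open>r + 2\<close>.
\<close>

lemma bailey_pair_mu_step:
  fixes X Y q S T V \<epsilon> E E1 E2 :: complex
  assumes nz: "q \<noteq> 0" "Y \<noteq> 0" "S \<noteq> 0" "X \<noteq> 1"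
    and rel: "E1 * (1 - X * Y * q) = E * (1 - X / Y)"
  shows "X * (2 * \<epsilon> * T * E * (1 - X / Y) / (1 - X) - S * T * V * (q * Y\<^sup>2) * (1 + Y * q) * E1)
       + S * T * (Y ^ 3 * q\<^sup>2) * (V - 2 * \<epsilon> / (S * Y\<^sup>2 * q))
           * (X * ((1 + 1 / (Y * q)) * E1 - q ^ 3 * Y\<^sup>2 * (1 + Y * q\<^sup>2) * E2))
       = X * (2 * (- \<epsilon>) * (T * Y * q) * E1 * (1 - X / (Y * q)) / (1 - X)
           - S * T * (Y ^ 3 * q\<^sup>2) * (V - 2 * \<epsilon> / (S * Y\<^sup>2 * q)) * (q ^ 3 * Y\<^sup>2) * (1 + Y * q\<^sup>2) * E2)"
proof -
  have "2 * \<epsilon> * T * E * (1 - X / Y) / (1 - X) = 2 * \<epsilon> * T * (E1 * (1 - X * Y * q)) / (1 - X)"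
    by (simp add: rel)
  then show ?thesis
    using nz by (simp add: divide_simps) algebra
qed

lemma bailey_pair_phi_step:
  fixes X Y q A E E1 E2 b2 :: complex
  assumes nz: "q \<noteq> 0" "Y \<noteq> 0"
    and rel: "E1 * (1 - X\<^sup>2 * Y\<^sup>2 * q\<^sup>2) = E * (1 - X\<^sup>2 / Y\<^sup>2)"
    and b1: "b1 = 1 + q * (Y * q)\<^sup>2 + q / (Y * q)\<^sup>2 - 2 * q * X\<^sup>2 - X ^ 4"
  shows "A * E * (1 - X\<^sup>2 / Y\<^sup>2) * (q * Y ^ 3 + (q + X\<^sup>2) * Y\<^sup>2 + Y) - A * (q\<^sup>2 * Y ^ 4) * b1 * E1
       + (- A * Y ^ 3 * q) * (b1 * E1 - q\<^sup>2 * (Y * q) ^ 4 * b2 * E2)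
       = (- A * Y ^ 3 * q) * E1 * (1 - X\<^sup>2 / (Y * q)\<^sup>2) * (q * (Y * q) ^ 3 + (q + X\<^sup>2) * (Y * q)\<^sup>2 + Y * q)
         - (- A * Y ^ 3 * q) * (q\<^sup>2 * (Y * q) ^ 4) * b2 * E2"
proof -
  have "A * E * (1 - X\<^sup>2 / Y\<^sup>2) = A * (E1 * (1 - X\<^sup>2 * Y\<^sup>2 * q\<^sup>2))"
    by (simp add: rel)
  then show ?thesis
    unfolding b1 using nz by (simp add: divide_simps) algebra
qed

lemma bailey_pair_sigma_step:
  fixes X Y q V T D \<epsilon> E E1 E2 b2 :: complex
  assumes nz: "q \<noteq> 0" "Y \<noteq> 0" "T \<noteq> 0" "X \<noteq> 1"
    and rel: "E1 * (1 - X * Y * q\<^sup>2) = E * (1 - X / Y)"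
    and D: "D = \<epsilon> * T * T"
    and b1: "b1 = 1 / (Y * q) + q * (Y * q) - 2 * q * X"
  shows "2 * V * q * Y * D * E * (1 - X / Y) + \<epsilon> * T * E * (1 - X / Y) * (1 - q * Y) / (1 - X)
           - (D * Y) * V * (q\<^sup>2 * Y) * b1 * E1
       + (- D * q\<^sup>2 * Y\<^sup>2 * (Y * q)) * (V + 1 / (T * Y * q))
           * (1 / (Y * q) * b1 * E1 - q\<^sup>2 * (Y * q) * b2 * E2)
       = 2 * (V + 1 / (T * Y * q)) * q * (Y * q) * (- D * q\<^sup>2 * Y\<^sup>2) * E1 * (1 - X / (Y * q))
           + (- \<epsilon>) * (T * Y * q) * E1 * (1 - X / (Y * q)) * (1 - q * (Y * q)) / (1 - X)
           - (- D * q\<^sup>2 * Y\<^sup>2 * (Y * q)) * (V + 1 / (T * Y * q)) * (q\<^sup>2 * (Y * q)) * b2 * E2"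
proof -
  have eq: "2 * V * q * Y * D * E * (1 - X / Y) + \<epsilon> * T * E * (1 - X / Y) * (1 - q * Y) / (1 - X)
     = 2 * V * q * Y * D * (E1 * (1 - X * Y * q\<^sup>2)) + \<epsilon> * T * (E1 * (1 - X * Y * q\<^sup>2)) * (1 - q * Y) / (1 - X)"
    by (simp add: rel)
  show ?thesis
    unfolding eq unfolding b1 D using nz by (simp add: field_simps) algebra
qed

lemma theta_partial_Suc:
  "theta_partial q (Suc r) = theta_partial q r - 2 * (-1) ^ r / q ^ ((Suc r)\<^sup>2)"
  by (simp add: theta_partial_def)

text \<open>A Bailey pair relative to \<open>a = 1\<close>, collected by partial theta sums instead
  of by kernel index. In the induction the recurrence of the right hand side in \<open>k\<close> is
  checked on the left, where the required difference telescopes in \<open>r\<close>.\<close>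

lemma bailey_pair_mu:
  assumes q: "q \<noteq> 0" and nz: "\<And>j. 0 < j \<Longrightarrow> j \<le> 2 * k \<Longrightarrow> q ^ j \<noteq> 1"
    and nz': "\<And>j. j \<le> k \<Longrightarrow> q ^ j \<noteq> -1"
  shows "(\<Sum>r\<le>k. q ^ (r * (3 * r + 1) div 2) * theta_partial q r *
            (bailey_kernel 0 q k r - q ^ (2 * r + 1) * bailey_kernel 0 q k (Suc r)))
         = 1 / qpoch (-q) q k"
  using nz nz'
proof (induction k)
  case 0
  then show ?case
    by (simp add: bailey_kernel_def theta_partial_def)
next
  case (Suc k)
  define X where "X = q ^ Suc k"
  define e where "e = bailey_kernel 0 q (Suc k)"
  define \<tau> where "\<tau> r = q ^ (r * (3 * r + 1) div 2)" for r
  define V where "V = theta_partial q"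
  define d where "d r = e r - q ^ (2 * r + 1) * e (Suc r)" for r
  define d' where "d' r = bailey_kernel 0 q k r - q ^ (2 * r + 1) * bailey_kernel 0 q k (Suc r)" for r
  have X: "X \<noteq> 1" "X \<noteq> -1"
    using Suc.prems(1)[of "Suc k"] Suc.prems(2)[of "Suc k"] by (auto simp: X_def)
  have rel: "e (Suc r) * (1 - X * q ^ r * q) = e r * (1 - X / q ^ r)" if "r \<le> Suc k" for r
    using bailey_kernel_Suc_right[of "Suc k" 0 q r] Suc.prems(1) that q by (simp add: e_def X_def)
  have e': "bailey_kernel 0 q k r = e r * (1 - X / q ^ r) * (1 - X * q ^ r)" for r
    using bailey_kernel_pred_left[of k 0 q r] Suc.prems(1) q by (simp add: e_def X_def)
  \<comment> \<open>The multiplier \<open>1 + X\<close> is the ratio of the right hand sides at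
    \<open>k\<close> and \<open>k + 1\<close>.\<close>
  have tm: "(1 + X) * d r - d' r =
      X * ((1 + 1 / q ^ r) * e r - q ^ (2 * r + 1) * (1 + q ^ Suc r) * e (Suc r))"
    if "r \<le> Suc k" for r
  proof -
    define Y where "Y = q ^ r"
    have Y: "q ^ Suc r = Y * q" "q ^ (2 * r + 1) = q * Y\<^sup>2" "Y \<noteq> 0"
      using q by (simp_all add: Y_def power2_eq_square mult_2 power_add)
    have "(1 + X) * d r - d' r =
        X * ((1 + 1 / Y) * e r - q * Y\<^sup>2 * (1 + Y * q) * e (Suc r))
        + X * Y * (e r * (1 - X / Y) - e (Suc r) * (1 - X * Y * q))"
      unfolding d_def d'_def e' Y Y_def[symmetric] using q Y(3)
      by (simp add: field_simps) algebra
    also have "e r * (1 - X / Y) - e (Suc r) * (1 - X * Y * q) = 0"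
      using rel[OF that] by (simp add: Y_def)
    finally show ?thesis
      unfolding Y Y_def[symmetric] by simp
  qed
  have sum: "(\<Sum>r\<le>M. \<tau> r * V r * ((1 + X) * d r - d' r)) =
      X * (2 * (-1) ^ M * q ^ (M * Suc M div 2) * e M * (1 - X / q ^ M) / (1 - X)
        - \<tau> M * V M * (q ^ (2 * M + 1)) * (1 + q ^ Suc M) * e (Suc M))" if "M \<le> Suc k" for M
    using that
  proof (induction M)
    case 0
    then show ?case
      using X(1) tm[of 0]
      by (simp add: \<tau>_def V_def theta_partial_def nonzero_mult_div_cancel_right)
  next
    case (Suc M)
    define Y where "Y = q ^ M"
    define T where "T = q ^ (M * Suc M div 2)"
    define S where "S = q ^ (M\<^sup>2)"
    have nz: "Y \<noteq> 0" "S \<noteq> 0" "q \<noteq> 0"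
      using q by (auto simp: Y_def S_def)
    have Y3: "q ^ (3 * M) = Y ^ 3"
      by (simp add: Y_def mult.commute flip: power_mult)
    have \<tau>: "\<tau> M = S * T" "\<tau> (Suc M) = S * T * (Y ^ 3 * q\<^sup>2)"
      unfolding \<tau>_def pentagonal_Suc unfolding pentagonal_eq_square_plus_triangular
      by (simp_all add: power_add S_def T_def Y3 power2_eq_square)
    have V: "V (Suc M) = V M - 2 * (-1) ^ M / (S * Y\<^sup>2 * q)"
      by (simp add: V_def theta_partial_Suc S_def Y_def power2_eq_square power_add algebra_simps)
    have T: "q ^ (Suc M * Suc (Suc M) div 2) = T * Y * q"
      unfolding triangular_Suc by (simp add: T_def Y_def power_add)
    have pw: "q ^ (2 * M + 1) = q * Y\<^sup>2" "q ^ Suc M = Y * q" "q ^ (2 * Suc M + 1) = q ^ 3 * Y\<^sup>2"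
      "q ^ Suc (Suc M) = Y * q\<^sup>2"
      by (simp_all add: Y_def power2_eq_square power3_eq_cube mult_2 power_add)
    have IH: "(\<Sum>r\<le>M. \<tau> r * V r * ((1 + X) * d r - d' r)) =
      X * (2 * (-1) ^ M * T * e M * (1 - X / Y) / (1 - X)
        - S * T * V M * (q * Y\<^sup>2) * (1 + Y * q) * e (Suc M))"
      using Suc unfolding pw \<tau> T_def[symmetric] Y_def[symmetric] by simp
    have rel': "e (Suc M) * (1 - X * Y * q) = e M * (1 - X / Y)"
      using rel[of M] Suc.prems by (simp add: Y_def)
    show ?case
      unfolding sum.atMost_Suc IH tm[OF Suc.prems] V pw \<tau> T
      using bailey_pair_mu_step[OF nz(3,1,2) X(1) rel', of "(-1) ^ M" T "V M" "e (Suc (Suc M))"]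
      by simp
  qed
  have "(1 + X) * (\<Sum>r\<le>Suc k. \<tau> r * V r * d r) - (\<Sum>r\<le>k. \<tau> r * V r * d' r) =
      (\<Sum>r\<le>Suc k. \<tau> r * V r * ((1 + X) * d r - d' r))"
    by (simp add: d'_def algebra_simps sum_distrib_left sum_subtractf sum.distrib)
  \<comment> \<open>At \<open>M = Suc k\<close> the first term of the closed form contains
    \<open>1 - X / q ^ Suc k = 0\<close>, the second the kernel at \<open>k + 2\<close>, which lies
    beyond the diagonal.\<close>
  also have "\<dots> = 0"
    using q by (subst sum) (simp_all add: X_def e_def)
  also have "(\<Sum>r\<le>k. \<tau> r * V r * d' r) = 1 / qpoch (-q) q k"
    using Suc unfolding \<tau>_def V_def d'_def by simp
  finally have "(1 + X) * (\<Sum>r\<le>Suc k. \<tau> r * V r * d r) = 1 / qpoch (-q) q k"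
    by simp
  moreover have "1 + X \<noteq> 0"
    using X(2) by (metis add.commute add_eq_0_iff)
  ultimately have "(\<Sum>r\<le>Suc k. \<tau> r * V r * d r) = 1 / (qpoch (-q) q k * (1 + X))"
    by (rule mult_eq_inverseD)
  then show ?case
    by (simp add: qpoch_Suc \<tau>_def V_def d_def e_def X_def)
qed

text \<open>Collected by kernel index, the coefficient for \<open>r > 0\<close> is
  \<open>(-1) ^ r * q ^ (r * (3 * r - 1) div 2) * (1 + q ^ r)\<close>. It has no inner sum, which is
  why \<open>\<phi>\<close> leads to a single sum and involves no Gauss sum.\<close>

lemma bailey_pair_phi:
  assumes q: "q \<noteq> 0" and nz: "\<And>j. 0 < j \<Longrightarrow> j \<le> 2 * k \<Longrightarrow> q ^ (2 * j) \<noteq> 1"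
    and nz': "\<And>j. j \<le> 2 * k \<Longrightarrow> q ^ j \<noteq> -1"
  shows "(\<Sum>r\<le>k. (-1) ^ r * q ^ (r * (3 * r + 1) div 2) / q ^ r *
            (bailey_kernel 0 (q\<^sup>2) k r - q ^ (4 * r + 2) * bailey_kernel 0 (q\<^sup>2) k (Suc r)))
         = 1 / (qpoch (-q) (q\<^sup>2) k * qpoch (q ^ 4) (q ^ 4) k)"
  using nz nz'
proof (induction k)
  case 0
  then show ?case
    by (simp add: bailey_kernel_def)
next
  case (Suc k)
  define X where "X = q ^ Suc k"
  \<comment> \<open>The ratio of the right hand sides at \<open>k\<close> and \<open>k + 1\<close>,
    as \<open>X\<^sup>2 / q = q ^ (2 * k + 1)\<close>.\<close>
  define L where "L = (1 + X\<^sup>2 / q) * (1 - X ^ 4)"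
  define e where "e = bailey_kernel 0 (q\<^sup>2) (Suc k)"
  define A where "A r = (-1) ^ r * q ^ (r * (3 * r + 1) div 2) / q ^ r" for r
  define d where "d r = e r - q ^ (4 * r + 2) * e (Suc r)" for r
  define d' where "d' r = bailey_kernel 0 (q\<^sup>2) k r - q ^ (4 * r + 2) * bailey_kernel 0 (q\<^sup>2) k (Suc r)" for r
  define b where "b r = 1 + q * (q ^ r)\<^sup>2 + q / (q ^ r)\<^sup>2 - 2 * q * X\<^sup>2 - X ^ 4" for r
  have nz2: "(q\<^sup>2) ^ j \<noteq> 1" if "0 < j" "j \<le> 2 * Suc k + 0" for j
    using Suc.prems(1)[of j] that by (simp add: power_mult)
  have sq: "(q\<^sup>2) ^ j = (q ^ j)\<^sup>2" for j
    by (simp add: mult.commute flip: power_mult)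
  have rel: "e (Suc r) * (1 - X\<^sup>2 * (q ^ r)\<^sup>2 * q\<^sup>2) = e r * (1 - X\<^sup>2 / (q ^ r)\<^sup>2)" if "r \<le> Suc k" for r
    using bailey_kernel_Suc_right[where k = "Suc k" and s = 0 and r = r, OF nz2] that q
    unfolding e_def X_def sq by simp
  have e': "bailey_kernel 0 (q\<^sup>2) k r = e r * (1 - X\<^sup>2 / (q ^ r)\<^sup>2) * (1 - X\<^sup>2 * (q ^ r)\<^sup>2)" for r
    using bailey_kernel_pred_left[where k = k and s = 0 and r = r, OF nz2] q
    unfolding e_def X_def sq by simp
  have tm: "L * d r - d' r = X\<^sup>2 / q * (b r * e r - q\<^sup>2 * (q ^ r) ^ 4 * b (Suc r) * e (Suc r))" for r
  proof -
    have be: "L * e r - bailey_kernel 0 (q\<^sup>2) k r = X\<^sup>2 / q * b r * e r" for r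
      unfolding e' b_def L_def using q by (simp add: field_simps)
    have "L * d r - d' r = (L * e r - bailey_kernel 0 (q\<^sup>2) k r)
        - q ^ (4 * r + 2) * (L * e (Suc r) - bailey_kernel 0 (q\<^sup>2) k (Suc r))"
      by (simp add: d_def d'_def algebra_simps)
    also have "q ^ (4 * r + 2) = q\<^sup>2 * (q ^ r) ^ 4"
      by (simp add: power_add power2_eq_square mult.commute flip: power_mult)
    finally show ?thesis
      unfolding be by (simp add: algebra_simps)
  qed
  have sum: "(\<Sum>r\<le>M. A r * (L * d r - d' r)) =
      X\<^sup>2 / q * (A M * e M * (1 - X\<^sup>2 / (q ^ M)\<^sup>2) * (q * (q ^ M) ^ 3 + (q + X\<^sup>2) * (q ^ M)\<^sup>2 + q ^ M)
        - A M * (q\<^sup>2 * (q ^ M) ^ 4) * b (Suc M) * e (Suc M))" if "M \<le> Suc k" for M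
    using that
  proof (induction M)
    case 0
    have "b 0 = (1 - X\<^sup>2) * (q + (q + X\<^sup>2) + 1)"
      by (simp add: b_def algebra_simps power4_eq_xxxx power2_eq_square)
    then show ?case
      by (simp add: tm A_def mult_ac)
  next
    case (Suc M)
    define Y where "Y = q ^ M"
    have Y: "q ^ Suc M = Y * q" "Y \<noteq> 0"
      using q by (simp_all add: Y_def)
    have Y3: "q ^ (3 * M) = Y ^ 3"
      by (simp add: Y_def mult.commute flip: power_mult)
    have A: "A (Suc M) = - A M * Y ^ 3 * q"
      unfolding A_def pentagonal_Suc power_add Y3 using q
      by (simp add: power2_eq_square)
    have rel': "e (Suc M) * (1 - X\<^sup>2 * Y\<^sup>2 * q\<^sup>2) = e M * (1 - X\<^sup>2 / Y\<^sup>2)"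
      using rel[of M] Suc.prems by (simp add: Y_def)
    have b1: "b (Suc M) = 1 + q * (Y * q)\<^sup>2 + q / (Y * q)\<^sup>2 - 2 * q * X\<^sup>2 - X ^ 4"
      unfolding b_def Y ..
    have IH: "(\<Sum>r\<le>M. A r * (L * d r - d' r)) =
      X\<^sup>2 / q * (A M * e M * (1 - X\<^sup>2 / Y\<^sup>2) * (q * Y ^ 3 + (q + X\<^sup>2) * Y\<^sup>2 + Y)
        - A M * (q\<^sup>2 * Y ^ 4) * b (Suc M) * e (Suc M))"
      unfolding Y_def using Suc by simp
    have "(\<Sum>r\<le>Suc M. A r * (L * d r - d' r)) = X\<^sup>2 / q *
        (A M * e M * (1 - X\<^sup>2 / Y\<^sup>2) * (q * Y ^ 3 + (q + X\<^sup>2) * Y\<^sup>2 + Y)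
        - A M * (q\<^sup>2 * Y ^ 4) * b (Suc M) * e (Suc M) + (- A M * Y ^ 3 * q) *
        (b (Suc M) * e (Suc M) - q\<^sup>2 * (Y * q) ^ 4 * b (Suc (Suc M)) * e (Suc (Suc M))))"
      unfolding sum.atMost_Suc IH unfolding tm A Y by (simp add: ring_distribs)
    then show ?case
      unfolding bailey_pair_phi_step[OF q Y(2) rel' b1] A Y .
  qed
  have "L * (\<Sum>r\<le>Suc k. A r * d r) - (\<Sum>r\<le>k. A r * d' r) = (\<Sum>r\<le>Suc k. A r * (L * d r - d' r))"
    by (simp add: d'_def algebra_simps sum_distrib_left sum_subtractf sum.distrib)
  also have "\<dots> = 0"
    using q by (subst sum) (simp_all add: X_def e_def)
  also have "(\<Sum>r\<le>k. A r * d' r) = 1 / (qpoch (-q) (q\<^sup>2) k * qpoch (q ^ 4) (q ^ 4) k)"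
    using Suc unfolding A_def d'_def by simp
  finally have main: "L * (\<Sum>r\<le>Suc k. A r * d r) = 1 / (qpoch (-q) (q\<^sup>2) k * qpoch (q ^ 4) (q ^ 4) k)"
    by simp
  have L: "1 + X\<^sup>2 / q = 1 + q * (q\<^sup>2) ^ k" "1 - X ^ 4 = 1 - q ^ 4 * (q ^ 4) ^ k"
    using q by (simp_all add: X_def power2_eq_square power_mult_distrib power4_eq_xxxx)
  have "X ^ 4 = q ^ (2 * (2 * Suc k))"
    unfolding X_def power_mult[symmetric] by (rule arg_cong[where f = "power q"]) simp
  then have "X ^ 4 \<noteq> 1"
    using Suc.prems(1)[of "2 * Suc k"] by simp
  moreover have "1 + q * (q\<^sup>2) ^ k \<noteq> 0"
    using Suc.prems(2)[of "Suc (2 * k)"] by (simp add: power_mult add_eq_0_iff)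
  ultimately have "L \<noteq> 0"
    by (simp add: L_def L(1))
  with main have "(\<Sum>r\<le>Suc k. A r * d r) = 1 / (qpoch (-q) (q\<^sup>2) k * qpoch (q ^ 4) (q ^ 4) k * L)"
    by (rule mult_eq_inverseD)
  then show ?case
    unfolding A_def d_def e_def L_def L qpoch_Suc by (simp add: mult_ac)
qed

definition inverse_triangular_partial :: "complex \<Rightarrow> nat \<Rightarrow> complex" where
  "inverse_triangular_partial q r = (\<Sum>j\<le>r. 1 / q ^ (j * Suc j div 2))"

text \<open>A pair relative to \<open>a = q\<close>. By \<open>bailey_kernel_Suc_right\<close> the
  bracket is \<open>1 / q ^ k\<close> times the difference of the kernel at \<open>r\<close> and
  \<open>r + 1\<close>; in that form it meets the conjugate sequence.\<close>

lemma bailey_pair_sigma: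
  assumes q: "q \<noteq> 0" and nz: "\<And>j. 0 < j \<Longrightarrow> j \<le> 2 * k + 1 \<Longrightarrow> q ^ j \<noteq> 1"
  shows "(\<Sum>r\<le>k. (-1) ^ r * q ^ (r\<^sup>2 + 2 * r) * inverse_triangular_partial q r *
            (bailey_kernel 1 q k r / q ^ r - q ^ (r + 2) * bailey_kernel 1 q k (Suc r)))
         = 1 / qpoch q (q\<^sup>2) (Suc k)"
  using nz
proof (induction k)
  case 0
  then show ?case
    by (simp add: bailey_kernel_def inverse_triangular_partial_def qpoch_Suc)
next
  case (Suc k)
  define X where "X = q ^ Suc k"
  define c where "c = bailey_kernel 1 q (Suc k)"
  define V where "V = inverse_triangular_partial q"
  define D where "D r = (-1) ^ r * (q ^ (r * Suc r div 2)) * q ^ (r * Suc r div 2)" for r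
  define A where "A r = (-1) ^ r * q ^ (r\<^sup>2 + 2 * r)" for r
  define b where "b r = 1 / q ^ r + q * q ^ r - 2 * q * X" for r
  define x where "x r = c r / q ^ r - q ^ (r + 2) * c (Suc r)" for r
  define x' where "x' r = bailey_kernel 1 q k r / q ^ r - q ^ (r + 2) * bailey_kernel 1 q k (Suc r)" for r
  have X: "X \<noteq> 1"
    using Suc.prems(1)[of "Suc k"] by (auto simp: X_def)
  have rel: "c (Suc r) * (1 - X * q ^ r * q\<^sup>2) = c r * (1 - X / q ^ r)" if "r \<le> Suc k" for r
    using bailey_kernel_Suc_right[of "Suc k" 1 q r] Suc.prems(1) that q
    by (simp add: c_def X_def power2_eq_square)
  have c': "bailey_kernel 1 q k r = c r * (1 - X / q ^ r) * (1 - X * q ^ r * q)" for r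
    using bailey_kernel_pred_left[of k 1 q r] Suc.prems(1) q by (simp add: c_def X_def)
  have tm: "(1 - q * X\<^sup>2) * x r - x' r =
      X * (1 / q ^ r * b r * c r - q\<^sup>2 * q ^ r * b (Suc r) * c (Suc r))" for r
  proof -
    have bc: "(1 - q * X\<^sup>2) * c r - bailey_kernel 1 q k r = X * b r * c r" for r
      unfolding c' b_def using q by (simp add: field_simps power2_eq_square)
    have "(1 - q * X\<^sup>2) * x r - x' r = ((1 - q * X\<^sup>2) * c r - bailey_kernel 1 q k r) / q ^ r
        - q ^ (r + 2) * ((1 - q * X\<^sup>2) * c (Suc r) - bailey_kernel 1 q k (Suc r))"
      by (simp add: x_def x'_def algebra_simps diff_divide_distrib add_divide_distrib)
    also have "q ^ (r + 2) = q\<^sup>2 * q ^ r"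
      by (simp add: power_add power2_eq_square)
    finally show ?thesis
      unfolding bc by (simp add: algebra_simps)
  qed
  \<comment> \<open>The exponent is twice a triangular number plus \<open>r\<close>. One of the two
    triangular powers cancels against the newest term of \<open>V\<close>, which produces the
    summand with \<open>(-1) ^ M\<close> in the closed form below.\<close>
  have AD: "A r = D r * q ^ r" for r
  proof -
    have "even (r * Suc r)"
      by simp
    then have eq: "r\<^sup>2 + 2 * r = r * Suc r div 2 + r * Suc r div 2 + r"
      by (metis (no_types, lifting) add_mult_distrib2 add.assoc add.commute div_add_self1
          even_two_times_div_two mult_2 mult_Suc_right power2_eq_square)
    show ?thesis
      unfolding A_def D_def eq by (simp only: power_add mult.assoc)
  qed
  have sum: "(\<Sum>r\<le>M. A r * V r * ((1 - q * X\<^sup>2) * x r - x' r)) =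
      X * (2 * V M * q * q ^ M * D M * c M * (1 - X / q ^ M)
        + (-1) ^ M * q ^ (M * Suc M div 2) * c M * (1 - X / q ^ M) * (1 - q * q ^ M) / (1 - X)
        - (D M * q ^ M) * V M * (q\<^sup>2 * q ^ M) * b (Suc M) * c (Suc M))" if "M \<le> Suc k" for M
    using that
  proof (induction M)
    case 0
    have "b 0 * c 0 = 2 * q * c 0 * (1 - X) + c 0 * (1 - X) * (1 - q) / (1 - X)"
    proof -
      have "c 0 * (1 - X) * (1 - q) / (1 - X) = c 0 * (1 - q)"
        using X by simp
      then show ?thesis
        by (simp only:) (simp add: b_def algebra_simps)
    qed
    moreover have "(\<Sum>r\<le>0. A r * V r * ((1 - q * X\<^sup>2) * x r - x' r)) = X * (b 0 * c 0 - q\<^sup>2 * b 1 * c 1)"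
      using tm[of 0] by (simp add: A_def V_def inverse_triangular_partial_def)
    ultimately show ?case
      by (simp add: D_def V_def inverse_triangular_partial_def mult_ac)
  next
    case (Suc M)
    define Y where "Y = q ^ M"
    define T where "T = q ^ (M * Suc M div 2)"
    have Y: "q ^ Suc M = Y * q" "Y \<noteq> 0" and T0: "T \<noteq> 0"
      using q by (simp_all add: Y_def T_def)
    have T: "q ^ (Suc M * Suc (Suc M) div 2) = T * Y * q"
      unfolding triangular_Suc by (simp add: T_def Y_def power_add)
    have D: "D (Suc M) = - D M * q\<^sup>2 * Y\<^sup>2" "D M = (-1) ^ M * T * T"
      unfolding D_def T by (simp_all add: T_def power2_eq_square mult_ac)
    have V: "V (Suc M) = V M + 1 / (T * Y * q)"
      unfolding V_def inverse_triangular_partial_def by (simp only: sum.atMost_Suc T)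
    have rel': "c (Suc M) * (1 - X * Y * q\<^sup>2) = c M * (1 - X / Y)"
      using rel[of M] Suc.prems by (simp add: Y_def)
    have b1: "b (Suc M) = 1 / (Y * q) + q * (Y * q) - 2 * q * X"
      unfolding b_def Y ..
    have IH: "(\<Sum>r\<le>M. A r * V r * ((1 - q * X\<^sup>2) * x r - x' r)) =
      X * (2 * V M * q * Y * D M * c M * (1 - X / Y)
        + (-1) ^ M * T * c M * (1 - X / Y) * (1 - q * Y) / (1 - X)
        - (D M * Y) * V M * (q\<^sup>2 * Y) * b (Suc M) * c (Suc M))"
      unfolding Y_def T_def using Suc by simp
    have "(\<Sum>r\<le>Suc M. A r * V r * ((1 - q * X\<^sup>2) * x r - x' r)) =
      X * (2 * V M * q * Y * D M * c M * (1 - X / Y)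
        + (-1) ^ M * T * c M * (1 - X / Y) * (1 - q * Y) / (1 - X)
        - (D M * Y) * V M * (q\<^sup>2 * Y) * b (Suc M) * c (Suc M)
        + (- D M * q\<^sup>2 * Y\<^sup>2 * (Y * q)) * (V M + 1 / (T * Y * q))
           * (1 / (Y * q) * b (Suc M) * c (Suc M) - q\<^sup>2 * (Y * q) * b (Suc (Suc M)) * c (Suc (Suc M))))"
      unfolding sum.atMost_Suc IH unfolding tm V AD D(1) Y by (simp add: ring_distribs)
    then show ?case
      unfolding bailey_pair_sigma_step[OF q Y(2) T0 X rel' D(2) b1] V D(1) Y T by simp
  qed
  have "(1 - q * X\<^sup>2) * (\<Sum>r\<le>Suc k. A r * V r * x r) - (\<Sum>r\<le>k. A r * V r * x' r) =
      (\<Sum>r\<le>Suc k. A r * V r * ((1 - q * X\<^sup>2) * x r - x' r))"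
    by (simp add: x'_def algebra_simps sum_distrib_left sum_subtractf sum.distrib)
  also have "\<dots> = 0"
    using q by (subst sum) (simp_all add: X_def c_def)
  also have "(\<Sum>r\<le>k. A r * V r * x' r) = 1 / qpoch q (q\<^sup>2) (Suc k)"
    using Suc unfolding A_def V_def x'_def by simp
  finally have main: "(1 - q * X\<^sup>2) * (\<Sum>r\<le>Suc k. A r * V r * x r) = 1 / qpoch q (q\<^sup>2) (Suc k)"
    by simp
  have L: "1 - q * X\<^sup>2 = 1 - q * (q\<^sup>2) ^ Suc k"
    by (simp add: X_def power2_eq_square power_mult_distrib)
  have "q * (q\<^sup>2) ^ Suc k \<noteq> 1"
    using Suc.prems[of "Suc (2 * Suc k)"] unfolding power_Suc[of q "2 * Suc k"] power_mult by simp
  then have "1 - q * X\<^sup>2 \<noteq> 0"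
    unfolding L by simp
  with main have "(\<Sum>r\<le>Suc k. A r * V r * x r) = 1 / (qpoch q (q\<^sup>2) (Suc k) * (1 - q * X\<^sup>2))"
    by (rule mult_eq_inverseD)
  then show ?case
    unfolding A_def V_def x_def c_def L qpoch_Suc[of _ _ "Suc k"] .
qed

section \<open>Conjugate Bailey sequences\<close>

text \<open>Every kernel value in the telescoping identities becomes a rational multiple of the
  single value \<open>bailey_kernel 1 q k r\<close>, which can then be cancelled as a common
  factor.\<close>

lemma bailey_kernel_diag:
  assumes "q \<noteq> 0" "q ^ (k + r + 2) \<noteq> 1" "\<forall>j. 0 < j \<and> j \<le> k \<longrightarrow> q ^ j \<noteq> 1"
  shows "bailey_kernel 0 q k (Suc r) = bailey_kernel 1 q k r * (1 - q ^ k / q ^ r)"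
    and "bailey_kernel 0 q (Suc k) (Suc r) = bailey_kernel 1 q k r / (1 - q ^ k * q ^ r * q\<^sup>2)"
    and "bailey_kernel 1 q k (Suc r) =
         bailey_kernel 1 q k r * (1 - q ^ k / q ^ r) / (1 - q ^ k * q ^ r * q\<^sup>2)"
proof -
  have p2: "q ^ (k + r + 2) = q ^ k * q ^ r * q\<^sup>2"
    by (simp add: power_add power2_eq_square)
  have P2: "qpoch q q (k + r + 2) = qpoch q q (k + r + 1) * (1 - q ^ k * q ^ r * q\<^sup>2)"
    by (simp add: qpoch_Suc power_add power2_eq_square mult_ac)
  have D: "r \<ge> k \<or> (\<exists>d. k = r + Suc d)"
    by (metis le_refl less_iff_Suc_add linorder_not_le add_Suc_right)
  show 1: "bailey_kernel 0 q k (Suc r) = bailey_kernel 1 q k r * (1 - q ^ k / q ^ r)"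
  proof (cases "r \<ge> k")
    case True
    then show ?thesis
      using assms(1) by (cases "r = k") auto
  next
    case False
    then obtain d where d: "k = r + Suc d"
      using D by blast
    have "q ^ Suc d \<noteq> 1"
      using assms(3)[rule_format, of "Suc d"] d by simp
    moreover have "q ^ k / q ^ r = q ^ Suc d"
      using assms(1) d by (simp add: power_add)
    ultimately show ?thesis
      by (simp add: bailey_kernel_def d qpoch_Suc)
  qed
  show 2: "bailey_kernel 0 q (Suc k) (Suc r) = bailey_kernel 1 q k r / (1 - q ^ k * q ^ r * q\<^sup>2)"
    using P2 by (simp add: bailey_kernel_def)
  have "bailey_kernel 1 q k (Suc r) = bailey_kernel 0 q k (Suc r) / (1 - q ^ k * q ^ r * q\<^sup>2)"
    using P2 by (simp add: bailey_kernel_def)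
  then show "bailey_kernel 1 q k (Suc r) =
         bailey_kernel 1 q k r * (1 - q ^ k / q ^ r) / (1 - q ^ k * q ^ r * q\<^sup>2)"
    unfolding 1 .
qed

text \<open>Creative telescoping in \<open>k\<close>, with induction on \<open>r\<close>. The upper
  boundary term vanishes because \<open>qpoch q q (2 * Suc h)\<close> contains
  \<open>1 - q ^ (2 * h + 1)\<close>. The bound \<open>r < h\<close> is essential: at
  \<open>k = r = h\<close> the kernel has a zero denominator.\<close>

lemma conjugate_bailey_phi:
  assumes q: "q \<noteq> 0" and root: "q ^ (2 * h + 1) = 1"
    and nz: "\<And>j. 0 < j \<Longrightarrow> j \<le> 2 * h \<Longrightarrow> q ^ (2 * j) \<noteq> 1" and "r < h"
  shows "(1 - q ^ (2 * r + 1)) * (\<Sum>k\<le>h. qpoch q q (2 * k) * q ^ k * bailey_kernel 1 (q\<^sup>2) k r) = q ^ r"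
  using \<open>r < h\<close>
proof (induction r)
  case 0
  define g where "g k = - (qpoch q q (2 * k) * q ^ k * bailey_kernel 0 (q\<^sup>2) k 0)" for k
  have "(1 - q) * (qpoch q q (2 * k) * q ^ k * bailey_kernel 1 (q\<^sup>2) k 0) = g (Suc k) - g k"
    if "k \<le> h" for k
  proof -
    define X where "X = q ^ k"
    have X2: "q ^ (2 * k) = X\<^sup>2" "(q\<^sup>2) ^ k = X\<^sup>2"
      by (simp_all add: X_def mult.commute flip: power_mult)
    have "q ^ (2 * Suc k) \<noteq> 1"
      using nz[of "Suc k"] that 0 by simp
    moreover have "q ^ (2 * Suc k) = q\<^sup>2 * X\<^sup>2"
      using X2(1) by (simp add: power2_eq_square)
    ultimately have Z: "1 - q\<^sup>2 * X\<^sup>2 \<noteq> 0"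
      by simp
    define U where "U = 1 / (qpoch (q\<^sup>2) (q\<^sup>2) k * qpoch (q\<^sup>2) (q\<^sup>2) k)"
    have U: "bailey_kernel 0 (q\<^sup>2) k 0 = U" "bailey_kernel 1 (q\<^sup>2) k 0 = U / (1 - q\<^sup>2 * X\<^sup>2)"
        "bailey_kernel 0 (q\<^sup>2) (Suc k) 0 = U / (1 - q\<^sup>2 * X\<^sup>2) / (1 - q\<^sup>2 * X\<^sup>2)"
      by (simp_all add: bailey_kernel_def U_def qpoch_Suc X2)
    have P2: "qpoch q q (2 * Suc k) = qpoch q q (2 * k) * (1 - q * X\<^sup>2) * (1 - q\<^sup>2 * X\<^sup>2)"
      by (simp add: qpoch_Suc X2 power2_eq_square)
    have pw: "q ^ Suc k = X * q"
      by (simp add: X_def)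
    show ?thesis
      unfolding g_def U P2 pw X_def[symmetric] using Z
      by (simp add: divide_simps) algebra
  qed
  then have "(1 - q) * (\<Sum>k\<le>h. qpoch q q (2 * k) * q ^ k * bailey_kernel 1 (q\<^sup>2) k 0) =
      (\<Sum>k\<le>h. g (Suc k) - g k)"
    by (simp add: sum_distrib_left)
  \<comment> \<open>Here the lower boundary value \<open>g 0 = -1\<close> supplies the whole
    result.\<close>
  also have "\<dots> = g (Suc h) - g 0"
    by (simp add: lessThan_Suc_atMost[symmetric] sum_lessThan_telescope)
  also have "qpoch q q (2 * Suc h) = 0"
    using root by (auto simp: qpoch_eq_0_iff intro!: exI[of _ "2 * h"])
  then have "g (Suc h) - g 0 = 1"
    by (simp add: g_def bailey_kernel_def)
  finally show ?case
    by simp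
next
  case (Suc r)
  define f where "f r k = qpoch q q (2 * k) * q ^ k * bailey_kernel 1 (q\<^sup>2) k r" for r k
  \<comment> \<open>The certificate is a multiple of the summand with kernel index
    \<open>Suc r\<close>, so its value at \<open>k = 0\<close> is zero and the recurrence in
    \<open>r\<close> is homogeneous.\<close>
  define g where "g k = - ((1 + q ^ (2 * r + 2)) / q * (qpoch q q (2 * k) * q ^ k * bailey_kernel 0 (q\<^sup>2) k (Suc r)))" for k
  have tel: "(1 - q ^ (2 * r + 3)) / q * f (Suc r) k - (1 - q ^ (2 * r + 1)) * f r k = g (Suc k) - g k"
    if "k \<le> h" for k
  proof -
    define X where "X = q ^ k"
    define Y where "Y = q ^ r"
    define C where "C = bailey_kernel 1 (q\<^sup>2) k r"
    define P where "P = qpoch q q (2 * k)"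
    have X2: "q ^ (2 * k) = X\<^sup>2" "(q\<^sup>2) ^ k = X\<^sup>2" and Y2: "q ^ (2 * r) = Y\<^sup>2" "(q\<^sup>2) ^ r = Y\<^sup>2"
      by (simp_all add: X_def Y_def mult.commute flip: power_mult)
    have q2: "q\<^sup>2 \<noteq> 0"
      using q by simp
    have nz1: "(q\<^sup>2) ^ (k + r + 2) \<noteq> 1"
      using nz[of "k + r + 2"] that Suc.prems unfolding power_mult by simp
    then have Z: "1 - X\<^sup>2 * Y\<^sup>2 * (q\<^sup>2)\<^sup>2 \<noteq> 0"
      unfolding power_add X2 Y2 by simp
    have nz2: "\<forall>j. 0 < j \<and> j \<le> k \<longrightarrow> (q\<^sup>2) ^ j \<noteq> 1"
      using nz that by (simp add: power_mult)
    note rels = bailey_kernel_diag[OF q2 nz1 nz2, unfolded X2 Y2, folded C_def]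
    have P2: "qpoch q q (2 * Suc k) = P * (1 - q * X\<^sup>2) * (1 - q\<^sup>2 * X\<^sup>2)"
      by (simp add: qpoch_Suc X2 P_def power2_eq_square)
    have pw: "q ^ (2 * r + 3) = q ^ 3 * Y\<^sup>2" "q ^ (2 * r + 1) = q * Y\<^sup>2" "q ^ (2 * r + 2) = q\<^sup>2 * Y\<^sup>2"
        "q ^ Suc k = X * q"
      unfolding power_add Y2 by (simp_all add: X_def)
    have "(1 - q ^ 3 * Y\<^sup>2) / q * (P * X * (C * (1 - X\<^sup>2 / Y\<^sup>2) / (1 - X\<^sup>2 * Y\<^sup>2 * (q\<^sup>2)\<^sup>2)))
        - (1 - q * Y\<^sup>2) * (P * X * C) =
      - ((1 + q\<^sup>2 * Y\<^sup>2) / q * (P * (1 - q * X\<^sup>2) * (1 - q\<^sup>2 * X\<^sup>2) * (X * q) * (C / (1 - X\<^sup>2 * Y\<^sup>2 * (q\<^sup>2)\<^sup>2))))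
      - - ((1 + q\<^sup>2 * Y\<^sup>2) / q * (P * X * (C * (1 - X\<^sup>2 / Y\<^sup>2))))"
    proof -
      have "Y \<noteq> 0"
        using q by (simp add: Y_def)
      then show ?thesis
        using q Z by (simp add: divide_simps) algebra
    qed
    then show ?thesis
      unfolding f_def g_def P2 pw rels P_def[symmetric] C_def[symmetric] X_def[symmetric] .
  qed
  have "(1 - q ^ (2 * r + 3)) / q * (\<Sum>k\<le>h. f (Suc r) k) - (1 - q ^ (2 * r + 1)) * (\<Sum>k\<le>h. f r k) =
      (\<Sum>k\<le>h. g (Suc k) - g k)"
    unfolding sum_distrib_left sum_subtractf[symmetric] using tel by (intro sum.cong) auto
  also have "\<dots> = g (Suc h) - g 0"
    by (simp add: lessThan_Suc_atMost[symmetric] sum_lessThan_telescope)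
  also have "qpoch q q (2 * Suc h) = 0"
    using root by (auto simp: qpoch_eq_0_iff intro!: exI[of _ "2 * h"])
  then have "g (Suc h) - g 0 = 0"
    by (simp add: g_def)
  also have "(1 - q ^ (2 * r + 1)) * (\<Sum>k\<le>h. f r k) = q ^ r"
    using Suc by (simp add: f_def)
  finally have "(1 - q ^ (2 * Suc r + 1)) * (\<Sum>k\<le>h. f (Suc r) k) = q * q ^ r"
    using q by (simp add: field_simps numeral_3_eq_3)
  then show ?case
    by (simp add: f_def)
qed

text \<open>Telescopes the ratio of consecutive members only. The certificate vanishes at
  \<open>n\<close> by the hypothesis on \<open>qpoch (-q) q n\<close> and at \<open>0\<close>
  because its kernel index is \<open>Suc r\<close>.\<close>

lemma conjugate_bailey_sigma:
  assumes q: "q \<noteq> 0" and zero: "qpoch (-q) q n = 0"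
    and nz: "\<And>j. 0 < j \<Longrightarrow> j < 2 * n \<Longrightarrow> q ^ j \<noteq> 1" and "Suc r < n"
  shows "(\<Sum>k<n. qpoch (-q) q k * q ^ (k * Suc k div 2) * bailey_kernel 1 q k (Suc r)) =
         q ^ Suc r * (\<Sum>k<n. qpoch (-q) q k * q ^ (k * Suc k div 2) * bailey_kernel 1 q k r)"
proof -
  define f where "f r k = qpoch (-q) q k * q ^ (k * Suc k div 2) * bailey_kernel 1 q k r" for r k
  define g where "g k = - ((1 - q ^ Suc r) * (qpoch (-q) q k * q ^ (k * Suc k div 2) * bailey_kernel 0 q k (Suc r)))" for k
  have tel: "f (Suc r) k - q ^ Suc r * f r k = g (Suc k) - g k"
    if "k < n" for k
  proof -
    define X where "X = q ^ k"
    define Y where "Y = q ^ r"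
    define C where "C = bailey_kernel 1 q k r"
    define P where "P = qpoch (-q) q k"
    define T where "T = q ^ (k * Suc k div 2)"
    have nz1: "q ^ (k + r + 2) \<noteq> 1"
      using nz[of "k + r + 2"] that assms(4) by simp
    then have Z: "1 - X * Y * q\<^sup>2 \<noteq> 0"
      unfolding power_add X_def Y_def by simp
    have nz2: "\<forall>j. 0 < j \<and> j \<le> k \<longrightarrow> q ^ j \<noteq> 1"
      using nz that by simp
    note rels = bailey_kernel_diag[OF q nz1 nz2, folded X_def Y_def, folded C_def]
    have P2: "qpoch (-q) q (Suc k) = P * (1 + q * X)"
      by (simp add: qpoch_Suc X_def P_def)
    have pw: "q ^ Suc r = q * Y"
      by (simp add: Y_def)
    have T2: "q ^ (Suc k * Suc (Suc k) div 2) = T * (q * X)"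
      unfolding triangular_Suc by (simp add: T_def X_def power_add)
    have "P * T * (C * (1 - X / Y) / (1 - X * Y * q\<^sup>2)) - q * Y * (P * T * C) =
      - ((1 - q * Y) * (P * (1 + q * X) * (T * (q * X)) * (C / (1 - X * Y * q\<^sup>2))))
      - - ((1 - q * Y) * (P * T * (C * (1 - X / Y))))"
    proof -
      have "Y \<noteq> 0"
        using q by (simp add: Y_def)
      then show ?thesis
        using q Z by (simp add: divide_simps) algebra
    qed
    then show ?thesis
      unfolding f_def g_def P2 T2 pw rels P_def[symmetric] T_def[symmetric] C_def[symmetric] .
  qed
  have "(\<Sum>k<n. f (Suc r) k) - q ^ Suc r * (\<Sum>k<n. f r k) = (\<Sum>k<n. g (Suc k) - g k)"
    by (simp add: sum_distrib_left tel flip: sum_subtractf del: power_Suc)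
  also have "\<dots> = g n - g 0"
    by (simp add: sum_lessThan_telescope)
  also have "\<dots> = 0"
    by (simp add: g_def zero)
  finally show ?thesis
    by (simp add: f_def)
qed

text \<open>For \<open>|q| < 1\<close> the corresponding infinite sum would diverge, its terms not
  tending to zero. Here the factor \<open>1 - q ^ (2 * h + 1)\<close> of
  \<open>qpoch q (q\<^sup>2) (Suc h)\<close> ends the telescoping.\<close>

lemma conjugate_bailey_mu:
  assumes q: "q \<noteq> 0" and root: "q ^ (2 * h + 1) = 1"
    and nz: "\<And>j. 0 < j \<Longrightarrow> j \<le> 2 * h \<Longrightarrow> q ^ j \<noteq> 1" and "r < h"
  shows "(\<Sum>k\<le>h. (-1) ^ k * qpoch q (q\<^sup>2) k * bailey_kernel 0 q k (Suc r)) =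
         - (\<Sum>k\<le>h. (-1) ^ k * qpoch q (q\<^sup>2) k * bailey_kernel 0 q k r)"
proof -
  define f where "f r k = (-1) ^ k * qpoch q (q\<^sup>2) k * bailey_kernel 0 q k r" for r k
  define g where "g k = - ((-1) ^ k * qpoch q (q\<^sup>2) k * (bailey_kernel 0 q k r * (1 - q ^ k / q ^ r)))" for k
  have tel: "f (Suc r) k + f r k = g (Suc k) - g k"
    if "k \<le> h" for k
  proof (cases "r \<le> k")
    case True
    define X where "X = q ^ k"
    define Y where "Y = q ^ r"
    define C where "C = bailey_kernel 1 q k r"
    define P where "P = qpoch q (q\<^sup>2) k"
    have Y: "Y \<noteq> 0"
      using q by (simp add: Y_def)
    have nz1: "q ^ (k + r + 1) \<noteq> 1"
      using nz[of "k + r + 1"] that assms(4) by simp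
    then have Z: "1 - X * Y * q \<noteq> 0"
      unfolding power_add X_def Y_def by simp
    have d1: "bailey_kernel 0 q k r = C * (1 - X * Y * q)"
      using Z by (simp add: C_def bailey_kernel_def qpoch_Suc X_def Y_def power_add mult_ac)
    have d2: "bailey_kernel 0 q k (Suc r) = C * (1 - X / Y)"
    proof (cases "r = k")
      case False
      then obtain d where d: "k = r + Suc d"
        using True by (metis less_iff_Suc_add nat_less_le add_Suc_right)
      have "q ^ Suc d \<noteq> 1"
        using nz[of "Suc d"] d that by auto
      moreover have "X / Y = q ^ Suc d"
        using q d by (simp add: X_def Y_def power_add)
      ultimately show ?thesis
        by (simp add: C_def bailey_kernel_def d qpoch_Suc)
    qed (use q in \<open>simp add: X_def Y_def\<close>)
    have d3: "bailey_kernel 0 q (Suc k) r * (1 - q ^ Suc k / q ^ r) = C"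
    proof -
      have e: "q ^ Suc k / q ^ r = q ^ (Suc k - r)"
        using True q by (simp add: power_diff del: power_Suc)
      have "q ^ (Suc k - r) \<noteq> 1"
        using nz[of "Suc k - r"] True that assms(4) by (cases r) auto
      moreover have "qpoch q q (Suc k - r) = qpoch q q (k - r) * (1 - q ^ (Suc k - r))"
        using True by (simp add: qpoch_Suc Suc_diff_le)
      ultimately show ?thesis
        unfolding e C_def using True by (simp add: bailey_kernel_def del: power_Suc)
    qed
    have P2: "qpoch q (q\<^sup>2) (Suc k) = P * (1 - q * X\<^sup>2)"
      by (simp add: qpoch_Suc P_def X_def power2_eq_square power_mult_distrib)
    show ?thesis
      unfolding f_def g_def d3 P2 unfolding d1 d2 P_def[symmetric] X_def[symmetric] Y_def[symmetric]
      using Y by (simp add: field_simps power2_eq_square)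
  next
    \<comment> \<open>Above the diagonal only \<open>r = Suc k\<close> could contribute to
      \<open>g (Suc k)\<close>, and there the factor \<open>1 - q ^ Suc k / q ^ r\<close> is
      zero.\<close>
    case False
    then have "bailey_kernel 0 q (Suc k) r * (1 - q ^ Suc k / q ^ r) = 0"
      using q by (cases "r = Suc k") (auto simp del: power_Suc)
    with False show ?thesis
      unfolding f_def g_def by simp
  qed
  have "(\<Sum>k\<le>h. f (Suc r) k) + (\<Sum>k\<le>h. f r k) = (\<Sum>k\<le>h. g (Suc k) - g k)"
    by (simp add: tel flip: sum.distrib)
  also have "\<dots> = g (Suc h) - g 0"
    by (simp add: lessThan_Suc_atMost[symmetric] sum_lessThan_telescope)
  also have "qpoch q (q\<^sup>2) (Suc h) = 0"
    using root by (auto simp: qpoch_eq_0_iff power_mult intro!: exI[of _ h])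
  then have "g (Suc h) - g 0 = 0"
    by (cases "r = 0") (auto simp: g_def)
  finally show ?thesis
    by (simp add: f_def add_eq_0_iff2)
qed

section \<open>Sums over roots of unity\<close>

lemma primitive_root_power_eq_1_iff:
  assumes "primitive_root n \<zeta>"
  shows "\<zeta> ^ j = 1 \<longleftrightarrow> n dvd j"
proof
  assume j: "\<zeta> ^ j = 1"
  have n: "0 < n" "\<zeta> ^ n = 1"
    using assms by (auto simp: primitive_root_def)
  have "\<zeta> ^ j = (\<zeta> ^ n) ^ (j div n) * \<zeta> ^ (j mod n)"
    by (simp flip: power_mult power_add)
  with n j have "\<zeta> ^ (j mod n) = 1"
    by simp
  with assms have "j mod n = 0"
    by (metis primitive_root_def mod_less_divisor neq0_conv)
  then show "n dvd j"
    by presburger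
next
  assume "n dvd j"
  with assms show "\<zeta> ^ j = 1"
    by (auto simp: primitive_root_def power_mult)
qed

lemma primitive_root_nonzero: "primitive_root n \<zeta> \<Longrightarrow> \<zeta> \<noteq> 0"
  by (auto simp: primitive_root_def power_0_left)

lemma primitive_root_powi_cong:
  assumes "primitive_root n \<zeta>" "int n dvd a - b"
  shows "\<zeta> powi a = \<zeta> powi b"
proof -
  obtain c where c: "a = b + int n * c"
    using assms(2) by (metis add.commute diff_add_cancel dvdE)
  have "\<zeta> powi (int n) = 1"
    using assms(1) by (simp add: primitive_root_def)
  then show ?thesis
    using primitive_root_nonzero[OF assms(1)] by (simp add: c power_int_add power_int_mult)
qed

lemma primitive_root_inverse:
  assumes "primitive_root n \<zeta>"
  shows "primitive_root n (inverse \<zeta>)"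
  using assms by (auto simp: primitive_root_def power_inverse)

lemma primitive_root_sqrt:
  assumes "primitive_root n q" "odd n"
  obtains s where "primitive_root n s" "s\<^sup>2 = q"
proof -
  \<comment> \<open>\<open>(n + 1) div 2\<close> is the inverse of 2 modulo the odd number
    \<open>n\<close>.\<close>
  define s where "s = q ^ ((n + 1) div 2)"
  have "(n + 1) div 2 * 2 = n + 1"
    using assms(2) by presburger
  then have "s\<^sup>2 = q ^ (n + 1)"
    unfolding s_def power_mult[symmetric] by (simp only:)
  then have s2: "s\<^sup>2 = q"
    using assms(1) by (simp add: primitive_root_def)
  have "s ^ n = (q ^ n) ^ ((n + 1) div 2)"
    by (simp add: s_def mult.commute flip: power_mult)
  moreover have "s ^ m \<noteq> 1" if "0 < m" "m < n" for m
  proof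
    assume "s ^ m = 1"
    then have "(s\<^sup>2) ^ m = 1"
      by (metis mult.commute power_mult power_one)
    with s2 that assms(1) show False
      by (auto simp: primitive_root_def)
  qed
  ultimately have "primitive_root n s"
    using assms(1) by (auto simp: primitive_root_def)
  with s2 show ?thesis
    using that by blast
qed

lemma sum_periodic_shift:
  fixes f :: "int \<Rightarrow> complex"
  assumes "\<And>x. f (x + int n) = f x"
  shows "(\<Sum>r<n. f (int r + c)) = (\<Sum>r<n. f (int r))"
proof -
  define S where "S c = (\<Sum>r<n. f (int r + c))" for c
  have step: "S (c + 1) = S c" for c
  proof -
    have "S (c + 1) + f c = (\<Sum>r<Suc n. f (int r + c))"
      unfolding S_def by (subst sum.lessThan_Suc_shift) (simp add: algebra_simps)
    also have "\<dots> = S c + f c"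
      using assms[of c] by (simp add: S_def add.commute)
    finally show ?thesis
      by simp
  qed
  have "S c = S 0"
  proof (induction c rule: int_induct[where k = 0])
    case (step2 i)
    then show ?case
      using step[of "i - 1"] by simp
  qed (simp_all add: step)
  then show ?thesis
    by (simp add: S_def)
qed

lemma root_sum_eq_0:
  fixes z :: complex
  assumes "z ^ n = 1" "z \<noteq> 1"
  shows "(\<Sum>y<n. z ^ y) = 0"
  using assms by (simp add: sum_gp_strict)

text \<open>The squared absolute value of the sum is \<open>n\<close>. Conjugation is expressed by
  negative exponents, and the shifted inner sum leaves a geometric sum in
  \<open>s ^ (2 * d)\<close>, which vanishes for \<open>0 < d < n\<close> because \<open>n\<close>
  is odd.\<close>

lemma gauss_sum_nonzero:
  assumes s: "primitive_root n s" and n: "odd n"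
  shows "(\<Sum>x<n. s powi ((int x)\<^sup>2 + b * int x)) \<noteq> 0"
proof
  assume zero: "(\<Sum>x<n. s powi ((int x)\<^sup>2 + b * int x)) = 0"
  have s0: "s \<noteq> 0"
    using primitive_root_nonzero[OF s] .
  have n0: "0 < n"
    using n by (cases n) auto
  have shift: "(\<Sum>x<n. s powi ((int x)\<^sup>2 + b * int x)) =
      (\<Sum>d<n. s powi ((int d + y)\<^sup>2 + b * (int d + y)))" for y
  proof (rule sum_periodic_shift[where f = "\<lambda>x. s powi (x\<^sup>2 + b * x)", symmetric])
    fix x
    have "(x + int n)\<^sup>2 + b * (x + int n) - (x\<^sup>2 + b * x) = int n * (2 * x + int n + b)"
      by (simp add: power2_eq_square algebra_simps)
    then show "s powi ((x + int n)\<^sup>2 + b * (x + int n)) = s powi (x\<^sup>2 + b * x)"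
      by (intro primitive_root_powi_cong[OF s]) simp
  qed
  have "0 = (\<Sum>y<n. s powi (- ((int y)\<^sup>2 + b * int y)) * (\<Sum>d<n. s powi ((int d + int y)\<^sup>2 + b * (int d + int y))))"
    using zero by (simp flip: shift)
  also have "\<dots> = (\<Sum>y<n. \<Sum>d<n. s powi ((int d)\<^sup>2 + b * int d) * (s ^ (2 * d)) ^ y)"
  proof (intro sum.cong refl)
    fix y
    have "s powi (- ((int y)\<^sup>2 + b * int y)) * s powi ((int d + int y)\<^sup>2 + b * (int d + int y)) =
        s powi ((int d)\<^sup>2 + b * int d) * (s ^ (2 * d)) ^ y" for d
    proof -
      have "(s ^ (2 * d)) ^ y = s powi (int (2 * d * y))"
        by (simp only: power_mult power_int_of_nat)
      then show ?thesis
        using s0 by (simp add: power2_eq_square algebra_simps flip: power_int_add)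
    qed
    then show "s powi (- ((int y)\<^sup>2 + b * int y)) * (\<Sum>d<n. s powi ((int d + int y)\<^sup>2 + b * (int d + int y))) =
        (\<Sum>d<n. s powi ((int d)\<^sup>2 + b * int d) * (s ^ (2 * d)) ^ y)"
      by (simp add: sum_distrib_left)
  qed
  also have "\<dots> = (\<Sum>d<n. s powi ((int d)\<^sup>2 + b * int d) * (\<Sum>y<n. (s ^ (2 * d)) ^ y))"
    by (subst sum.swap) (simp add: sum_distrib_left)
  also have "\<dots> = (\<Sum>d<n. if d = 0 then of_nat n else 0)"
  proof (intro sum.cong refl)
    fix d assume d: "d \<in> {..<n}"
    show "s powi ((int d)\<^sup>2 + b * int d) * (\<Sum>y<n. (s ^ (2 * d)) ^ y) = (if d = 0 then of_nat n else 0)"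
    proof (cases "d = 0")
      case False
      have "\<not> n dvd 2 * d"
        using False d n by (metis coprime_dvd_mult_right_iff coprime_right_2_iff_odd dvd_imp_le
            lessThan_iff linorder_not_less neq0_conv)
      then have "s ^ (2 * d) \<noteq> 1"
        by (simp add: primitive_root_power_eq_1_iff[OF s])
      moreover have "(s ^ (2 * d)) ^ n = 1"
        using s by (metis mult.commute power_mult power_one primitive_root_def)
      ultimately show ?thesis
        using False root_sum_eq_0 by simp
    qed simp
  qed
  also have "\<dots> = of_nat n"
    using n0 by simp
  finally show False
    using n0 by simp
qed

lemma minus_one_powi_eq: "(-1 :: complex) powi j = (if even j then 1 else -1)"
  by (auto elim!: evenE oddE simp: power_int_add power_int_mult)

lemma theta_partial_eq:
  assumes "q \<noteq> 0"
  shows "theta_partial q m = (\<Sum>j = - int m..int m. (-1) powi j * q powi (- j\<^sup>2))"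
proof (induction m)
  case 0
  then show ?case
    by (simp add: theta_partial_def)
next
  case (Suc m)
  have split: "{- int (Suc m)..int (Suc m)} = insert (int m + 1) (insert (- int m - 1) {- int m..int m})"
    by auto
  have "(-1) ^ Suc m / q ^ ((Suc m)\<^sup>2) = (-1) powi (int m + 1) * q powi (- (int m + 1)\<^sup>2)"
  proof -
    have "(int m + 1)\<^sup>2 = int ((Suc m)\<^sup>2)"
      by simp
    then have "q powi (- (int m + 1)\<^sup>2) = 1 / q ^ ((Suc m)\<^sup>2)"
      by (simp only: power_int_minus power_int_of_nat inverse_eq_divide)
    then show ?thesis
      by (simp add: minus_one_powi_eq minus_one_power_iff)
  qed
  moreover have "(-1) powi (- int m - 1) * q powi (- (- int m - 1)\<^sup>2) =
      (-1) powi (int m + 1) * q powi (- (int m + 1)\<^sup>2)"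
    by (simp add: minus_one_powi_eq power2_eq_square algebra_simps)
  ultimately show ?case
    unfolding split by (simp add: theta_partial_def Suc[symmetric] algebra_simps)
qed

text \<open>Turns a partial theta sum into a sum over a full period. With
  \<open>n = 2 * h + 1\<close> the reflection \<open>j \<mapsto> n - j\<close> preserves
  \<open>j\<^sup>2\<close> modulo \<open>n\<close> and reverses \<open>(-1) ^ j\<close>, so for
  \<open>r \<le> h\<close> the part of the window beyond \<open>r\<close> cancels in pairs. For
  larger \<open>r\<close> the window is first reflected at 0.\<close>

lemma sum_theta_window:
  assumes q: "primitive_root (2 * h + 1) q" and "r \<le> 2 * h"
  shows "(\<Sum>l<2 * h + 1. (-1) powi (int l - int r) * q powi (- (int l - int r)\<^sup>2)) =
         theta_partial q (min r (2 * h - r))"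
proof -
  have q0: "q \<noteq> 0"
    using primitive_root_nonzero[OF q] .
  define a where "a j = (-1) powi j * q powi (- j\<^sup>2)" for j :: int
  have sym: "a (- j) = a j" for j
    by (simp add: a_def minus_one_powi_eq)
  have anti: "a (2 * int h + 1 - j) = - a j" for j
  proof -
    have "- (2 * int h + 1 - j)\<^sup>2 - - j\<^sup>2 = int (2 * h + 1) * (2 * j - 2 * int h - 1)"
      by (simp add: power2_eq_square algebra_simps)
    then have "q powi (- (2 * int h + 1 - j)\<^sup>2) = q powi (- j\<^sup>2)"
      by (intro primitive_root_powi_cong[OF q]) simp
    then show ?thesis
      by (simp add: a_def minus_one_powi_eq)
  qed
  have main: "(\<Sum>j = - int r..2 * int h - int r. a j) = theta_partial q r" if "r \<le> h" for r
  proof -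
    define Z where "Z = {int r + 1..2 * int h - int r}"
    have "(\<Sum>j\<in>Z. a j) = (\<Sum>j\<in>Z. a (2 * int h + 1 - j))"
      by (rule sum.reindex_bij_witness[where i = "\<lambda>j. 2 * int h + 1 - j" and j = "\<lambda>j. 2 * int h + 1 - j"])
         (auto simp: Z_def)
    also have "\<dots> = - (\<Sum>j\<in>Z. a j)"
      by (simp add: anti sum_negf)
    finally have "(\<Sum>j\<in>Z. a j) = 0"
      by simp
    moreover have "{- int r..2 * int h - int r} = {- int r..int r} \<union> Z"
      using that by (auto simp: Z_def)
    moreover have "(\<Sum>j\<in>{- int r..int r} \<union> Z. a j) = (\<Sum>j = - int r..int r. a j) + (\<Sum>j\<in>Z. a j)"
      by (rule sum.union_disjoint) (auto simp: Z_def)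
    ultimately show ?thesis
      by (simp add: theta_partial_eq[OF q0] a_def)
  qed
  have "(\<Sum>l<2 * h + 1. a (int l - int r)) = (\<Sum>j = - int r..2 * int h - int r. a j)"
    by (rule sum.reindex_bij_witness[where i = "\<lambda>j. nat (j + int r)" and j = "\<lambda>l. int l - int r"]) auto
  also have "\<dots> = theta_partial q (min r (2 * h - r))"
  proof (cases "r \<le> h")
    case True
    then have "min r (2 * h - r) = r"
      by simp
    with True show ?thesis
      using main by simp
  next
    case False
    have "(\<Sum>j = - int r..2 * int h - int r. a j) = (\<Sum>j = - int (2 * h - r)..2 * int h - int (2 * h - r). a j)"
      by (rule sum.reindex_bij_witness[where i = uminus and j = uminus])
         (use assms(2) sym in auto)
    moreover have "min r (2 * h - r) = 2 * h - r" "2 * h - r \<le> h"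
      using False by auto
    ultimately show ?thesis
      using main[of "2 * h - r"] by simp
  qed
  finally show ?thesis
    by (simp add: a_def)
qed

section \<open>Evaluation at roots of unity\<close>

text \<open>The sum \<open>W n s\<close>. Its exponents are twice the generalized pentagonal
  numbers, so passing to a square root of the base replaces halving them.\<close>

definition pentagonal_sum :: "nat \<Rightarrow> complex \<Rightarrow> complex" where
  "pentagonal_sum n s = (\<Sum>k<n. (-1) ^ k * s ^ (k * (3 * k + 1)))"

lemma sum_fold_middle:
  fixes w :: "nat \<Rightarrow> complex"
  shows "(\<Sum>k<2 * h + 1. w k) = (\<Sum>r<h. w r + w (2 * h - r)) + w h"
proof -
  have "(\<Sum>k<2 * h + 1. w k) = (\<Sum>k\<in>{..<h} \<union> {h} \<union> {h<..2 * h}. w k)"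
    by (rule sum.cong) auto
  also have "\<dots> = (\<Sum>k<h. w k) + w h + (\<Sum>k\<in>{h<..2 * h}. w k)"
    by (subst sum.union_disjoint; (subst sum.union_disjoint)?) auto
  also have "(\<Sum>k\<in>{h<..2 * h}. w k) = (\<Sum>r<h. w (2 * h - r))"
    by (rule sum.reindex_bij_witness[where i = "\<lambda>r. 2 * h - r" and j = "\<lambda>r. 2 * h - r"]) auto
  finally show ?thesis
    by (simp add: sum.distrib)
qed

lemma sum_triangle_swap:
  fixes d :: "nat \<Rightarrow> nat \<Rightarrow> complex"
  assumes "\<And>k r. k < r \<Longrightarrow> d k r = 0"
  shows "(\<Sum>k\<le>h. f k * (\<Sum>r\<le>k. A r * d k r)) = (\<Sum>r\<le>h. A r * (\<Sum>k\<le>h. f k * d k r))"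
proof -
  have "(\<Sum>r\<le>k. A r * d k r) = (\<Sum>r\<le>h. A r * d k r)" if "k \<le> h" for k
    by (rule sum.mono_neutral_left) (use that assms in auto)
  then have "(\<Sum>k\<le>h. f k * (\<Sum>r\<le>k. A r * d k r)) = (\<Sum>k\<le>h. \<Sum>r\<le>h. A r * (f k * d k r))"
    by (simp add: sum_distrib_left mult_ac)
  also have "\<dots> = (\<Sum>r\<le>h. A r * (\<Sum>k\<le>h. f k * d k r))"
    by (subst sum.swap) (simp add: sum_distrib_left)
  finally show ?thesis .
qed

text \<open>Modulo \<open>2 * h + 1\<close> the reflection is \<open>r \<mapsto> -1 - r\<close>, and
  \<open>(r + 1) (3 r + 2) = r (3 r + 1) + 2 (2 r + 1)\<close>. Thus a half sum weighted by
  \<open>1 + q ^ (2 * r + 1)\<close>, where \<open>q = s\<^sup>2\<close>, is a sum over a full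
  period.\<close>

lemma pentagonal_power_reflect:
  assumes s: "primitive_root (2 * h + 1) s" and "r \<le> 2 * h"
  shows "s ^ ((2 * h - r) * (3 * (2 * h - r) + 1)) = s ^ (r * (3 * r + 1)) * (s\<^sup>2) ^ (2 * r + 1)"
proof -
  define k where "k = 2 * h - r"
  have k: "int k = 2 * int h - int r"
    using assms(2) by (simp add: k_def)
  have "int (k * (3 * k + 1)) - int (r * (3 * r + 1) + 2 * (2 * r + 1)) =
      int (2 * h + 1) * (6 * int h - 6 * int r - 2)"
    by (simp add: k algebra_simps)
  then have "s powi int (k * (3 * k + 1)) = s powi int (r * (3 * r + 1) + 2 * (2 * r + 1))"
    by (intro primitive_root_powi_cong[OF s]) simp
  then show ?thesis
    unfolding power_int_of_nat k_def power_add power_mult[of s 2] .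
qed

lemma power_pentagonal_sqrt: "(s\<^sup>2) ^ (r * (3 * r + 1) div 2) = (s :: complex) ^ (r * (3 * r + 1))"
proof -
  have "2 * (r * (3 * r + 1) div 2) = r * (3 * r + 1)"
    by simp
  then show ?thesis
    unfolding power_mult[symmetric] by simp
qed

section \<open>Splitting and inversion of shifted factorials\<close>

lemma qpoch_double: "qpoch a q (2 * k) = qpoch a (q\<^sup>2) k * qpoch (a * q) (q\<^sup>2) k"
proof (induction k)
  case (Suc k)
  have "qpoch a q (2 * Suc k) = qpoch a q (2 * k) * (1 - a * (q\<^sup>2) ^ k) * (1 - a * q * (q\<^sup>2) ^ k)"
    by (simp add: qpoch_Suc power_mult mult.assoc)
  then show ?case
    unfolding Suc by (simp add: qpoch_Suc mult_ac)
qed simp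

lemma qpoch_square: "qpoch (a\<^sup>2) (q\<^sup>2) k = qpoch a q k * qpoch (-a) q k"
proof (induction k)
  case (Suc k)
  have "1 - a\<^sup>2 * (q\<^sup>2) ^ k = (1 - a * q ^ k) * (1 + a * q ^ k)"
    by (simp add: power2_eq_square power_mult_distrib algebra_simps)
  then show ?case
    by (simp add: qpoch_Suc Suc mult_ac)
qed simp

lemma qpoch_add: "qpoch a q (k + m) = qpoch a q k * qpoch (a * q ^ k) q m"
  by (induction m) (simp_all add: qpoch_Suc power_add mult_ac)

lemma qpoch_invert_odd:
  assumes "q \<noteq> 0"
  shows "qpoch (inverse q) ((inverse q)\<^sup>2) k = (-1) ^ k / q ^ (k\<^sup>2) * qpoch q (q\<^sup>2) k"
proof (induction k)
  case (Suc k)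
  have "1 - inverse q * ((inverse q)\<^sup>2) ^ k = - (1 / q ^ (2 * k + 1)) * (1 - q * (q\<^sup>2) ^ k)"
  proof -
    have "((inverse q)\<^sup>2) ^ k = inverse ((q\<^sup>2) ^ k)" "q ^ (2 * k + 1) = q * (q\<^sup>2) ^ k"
      by (simp_all add: power_inverse power_mult)
    then show ?thesis
      using assms by (simp only:) (simp add: field_simps)
  qed
  moreover have "q ^ ((Suc k)\<^sup>2) = q ^ (k\<^sup>2) * q ^ (2 * k + 1)"
    unfolding power_add[symmetric] by (rule arg_cong[where f = "power q"]) (simp add: power2_eq_square)
  ultimately show ?case
    by (simp add: qpoch_Suc Suc)
qed simp

lemma qpoch_invert_double:
  assumes "q \<noteq> 0"
  shows "qpoch (- inverse q) (inverse q) (2 * k) = qpoch (-q) q (2 * k) / q ^ (2 * k\<^sup>2 + k)"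
proof (induction k)
  case (Suc k)
  have f: "1 - - inverse q * inverse q ^ j = 1 / q ^ Suc j * (1 - - q * q ^ j)" for j
    using assms by (simp add: field_simps power_inverse)
  have "2 * (Suc k)\<^sup>2 + Suc k = (2 * k\<^sup>2 + k) + Suc (2 * k) + Suc (Suc (2 * k))"
    by (simp add: power2_eq_square)
  then have p: "q ^ (2 * (Suc k)\<^sup>2 + Suc k) = q ^ (2 * k\<^sup>2 + k) * q ^ Suc (2 * k) * q ^ Suc (Suc (2 * k))"
    by (simp only: power_add)
  have two: "2 * Suc k = Suc (Suc (2 * k))"
    by simp
  show ?case
    unfolding p unfolding two qpoch_Suc Suc f by (simp del: power_Suc)
qed simp

text \<open>Doubling permutes the exponents \<open>1, ..., 2 h\<close> modulo
  \<open>2 h + 1\<close>: those exceeding \<open>2 h\<close> wrap around to the odd ones.\<close>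

lemma odd_root_qpoch_square:
  assumes "q ^ (2 * h + 1) = 1"
  shows "qpoch (q\<^sup>2) (q\<^sup>2) (2 * h) = qpoch q q (2 * h)"
proof -
  have "q\<^sup>2 * (q\<^sup>2) ^ h = q"
  proof -
    have "q\<^sup>2 * (q\<^sup>2) ^ h = q * q ^ (2 * h + 1)"
      by (simp add: power2_eq_square power_mult_distrib mult_2 power_add)
    then show ?thesis
      unfolding assms by simp
  qed
  then show ?thesis
    using qpoch_add[of "q\<^sup>2" "q\<^sup>2" h h] qpoch_double[of q q h] by (simp flip: mult_2 power2_eq_square)
qed

text \<open>The passage from \<open>a = 1\<close> to \<open>a = q\<close>: both kernel values are
  multiples of the one on the right, and the two terms with \<open>q ^ (k + r + 1)\<close>
  cancel.\<close>

lemma bailey_kernel_combine: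
  assumes q: "q \<noteq> 0" and nz: "\<And>j. 0 < j \<Longrightarrow> j \<le> k + r + 1 \<Longrightarrow> q ^ j \<noteq> 1"
  shows "bailey_kernel 0 q k r - q ^ (2 * r + 1) * bailey_kernel 0 q k (Suc r) =
         (1 - q ^ (2 * r + 1)) * bailey_kernel 1 q k r"
proof (cases "r \<le> k")
  case True
  have Z: "q ^ (k + r + 1) \<noteq> 1"
    using nz[of "k + r + 1"] by simp
  have d1: "bailey_kernel 0 q k r = bailey_kernel 1 q k r * (1 - q ^ (k + r + 1))"
    using Z by (simp add: bailey_kernel_def qpoch_Suc)
  have d2: "bailey_kernel 0 q k (Suc r) = bailey_kernel 1 q k r * (1 - q ^ (k - r))"
  proof (cases "r = k")
    case False
    with True have "k - r = Suc (k - Suc r)" "q ^ (k - r) \<noteq> 1"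
      using nz[of "k - r"] by auto
    then show ?thesis
      using True False by (simp add: bailey_kernel_def qpoch_Suc)
  qed simp
  have "q ^ (2 * r + 1) * q ^ (k - r) = q ^ (k + r + 1)"
    using True by (simp add: add.commute flip: power_add power_Suc)
  then show ?thesis
    unfolding d1 d2 by (simp add: algebra_simps del: power_Suc)
qed simp

lemma mock_phi_eq_pentagonal_sum:
  assumes \<zeta>: "primitive_root (2 * h + 1) \<zeta>" and s: "primitive_root (2 * h + 1) s" "s\<^sup>2 = inverse \<zeta>"
  shows "mock_phi \<zeta> = pentagonal_sum (2 * h + 1) s"
proof -
  define n where "n = 2 * h + 1"
  \<comment> \<open>In the base \<open>1 / \<zeta>\<close> the powers with quadratic exponents
    cancel: the \<open>k\<close>-th term of the series becomes
    \<open>q ^ k * qpoch q (q\<^sup>2) k / qpoch (-q) q (2 * k)\<close>.\<close>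
  define q where "q = inverse \<zeta>"
  have odd: "odd n"
    by (simp add: n_def)
  have q: "primitive_root n q"
    using primitive_root_inverse[OF \<zeta>] by (simp add: q_def n_def)
  have q0: "q \<noteq> 0"
    using primitive_root_nonzero[OF q] .
  have root: "q ^ (2 * h + 1) = 1"
    using q by (simp add: primitive_root_def n_def)
  have \<zeta>q: "\<zeta> = inverse q"
    by (simp add: q_def)
  have nz: "q ^ (2 * j) \<noteq> 1" if "0 < j" "j \<le> 2 * h" for j
  proof -
    have "\<not> n dvd 2 * j"
      using that odd by (metis coprime_dvd_mult_right_iff coprime_right_2_iff_odd dvd_imp_le
          n_def linorder_not_less Suc_eq_plus1 le_imp_less_Suc)
    then show ?thesis
      by (simp add: primitive_root_power_eq_1_iff[OF q])
  qed
  have nz': "(q\<^sup>2) ^ j \<noteq> 1" if "0 < j" "j \<le> 2 * h" for j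
    using nz[OF that] by (simp add: power_mult)
  define f where "f k = qpoch q q (2 * k) * q ^ k" for k
  define A where "A r = (-1) ^ r * q ^ (r * (3 * r + 1) div 2) / q ^ r" for r
  define d where "d k r = bailey_kernel 0 (q\<^sup>2) k r - q ^ (4 * r + 2) * bailey_kernel 0 (q\<^sup>2) k (Suc r)" for k r
  have "mock_phi \<zeta> = (\<Sum>k<n. (-1) ^ k * \<zeta> ^ (k\<^sup>2) * qpoch \<zeta> (\<zeta>\<^sup>2) k / qpoch (-\<zeta>) \<zeta> (2 * k))"
    using mock_theta_at_odd_root(1)[of n \<zeta>] \<zeta> odd by (simp add: n_def)
  also have "\<dots> = (\<Sum>k\<le>h. (-1) ^ k * \<zeta> ^ (k\<^sup>2) * qpoch \<zeta> (\<zeta>\<^sup>2) k / qpoch (-\<zeta>) \<zeta> (2 * k))"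
  proof (rule sum.mono_neutral_right)
    have "\<zeta> * (\<zeta>\<^sup>2) ^ h = 1"
      using \<zeta> by (simp add: primitive_root_def power_mult)
    then have "qpoch \<zeta> (\<zeta>\<^sup>2) k = 0" if "h < k" for k
      using that by (auto simp: qpoch_eq_0_iff)
    then show "\<forall>k\<in>{..<n} - {..h}. (-1) ^ k * \<zeta> ^ (k\<^sup>2) * qpoch \<zeta> (\<zeta>\<^sup>2) k / qpoch (-\<zeta>) \<zeta> (2 * k) = 0"
      by auto
  qed (auto simp: n_def)
  also have "\<dots> = (\<Sum>k\<le>h. f k * (\<Sum>r\<le>k. A r * d k r))"
  proof (intro sum.cong refl)
    fix k assume "k \<in> {..h}"
    then have k: "k \<le> h"
      by simp
    have "qpoch (q\<^sup>2) (q\<^sup>2) k \<noteq> 0"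
      using nz' k by (intro qpoch_self_nonzero) auto
    moreover have "qpoch (q ^ 4) (q ^ 4) k = qpoch (q\<^sup>2) (q\<^sup>2) k * qpoch (- q\<^sup>2) (q\<^sup>2) k"
      using qpoch_square[of "q\<^sup>2" "q\<^sup>2" k] by (simp flip: power_mult)
    moreover have "qpoch (-q) q (2 * k) = qpoch (-q) (q\<^sup>2) k * qpoch (- q\<^sup>2) (q\<^sup>2) k"
      using qpoch_double[of "-q" q k] by (simp add: power2_eq_square)
    moreover have "qpoch q q (2 * k) = qpoch q (q\<^sup>2) k * qpoch (q\<^sup>2) (q\<^sup>2) k"
      using qpoch_double[of q q k] by (simp add: power2_eq_square)
    ultimately have "qpoch q (q\<^sup>2) k / qpoch (-q) q (2 * k) =
        qpoch q q (2 * k) * (1 / (qpoch (-q) (q\<^sup>2) k * qpoch (q ^ 4) (q ^ 4) k))"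
      by simp
    also have "1 / (qpoch (-q) (q\<^sup>2) k * qpoch (q ^ 4) (q ^ 4) k) = (\<Sum>r\<le>k. A r * d k r)"
      unfolding A_def d_def
      by (rule bailey_pair_phi[symmetric])
         (use q0 nz k odd_root_power_neq_minus_1[OF odd q] in auto)
    finally have eq: "qpoch q (q\<^sup>2) k / qpoch (-q) q (2 * k) = qpoch q q (2 * k) * (\<Sum>r\<le>k. A r * d k r)" .
    have "(-1) ^ k * \<zeta> ^ (k\<^sup>2) * qpoch \<zeta> (\<zeta>\<^sup>2) k / qpoch (-\<zeta>) \<zeta> (2 * k) =
        (-1) ^ k * inverse q ^ (k\<^sup>2) * ((-1) ^ k / q ^ (k\<^sup>2) * qpoch q (q\<^sup>2) k) /
        (qpoch (-q) q (2 * k) / q ^ (2 * k\<^sup>2 + k))"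
      unfolding \<zeta>q qpoch_invert_odd[OF q0] qpoch_invert_double[OF q0] ..
    also have "\<dots> = q ^ k * (qpoch q (q\<^sup>2) k / qpoch (-q) q (2 * k))"
      using q0 by (simp add: power_add mult_2 power_inverse field_simps flip: power_mult_distrib)
    finally show "(-1) ^ k * \<zeta> ^ (k\<^sup>2) * qpoch \<zeta> (\<zeta>\<^sup>2) k / qpoch (-\<zeta>) \<zeta> (2 * k) =
        f k * (\<Sum>r\<le>k. A r * d k r)"
      unfolding eq f_def by simp
  qed
  also have "\<dots> = (\<Sum>r\<le>h. A r * (\<Sum>k\<le>h. f k * d k r))"
    by (rule sum_triangle_swap) (simp add: d_def)
  also have "\<dots> = (\<Sum>r<h. A r * (\<Sum>k\<le>h. f k * d k r)) + A h * (\<Sum>k\<le>h. f k * d k h)"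
    by (simp add: lessThan_Suc_atMost[symmetric])
  \<comment> \<open>The index \<open>r = h\<close> is outside the range of
    \<open>conjugate_bailey_phi\<close>. It is evaluated directly from the single term
    \<open>k = h\<close>, and becomes the unpaired middle term of the full period.\<close>
  also have "(\<Sum>k\<le>h. f k * d k h) = f h * d h h"
  proof (subst sum.remove[of _ h])
    have "(\<Sum>k\<in>{..h} - {h}. f k * d k h) = 0"
      by (rule sum.neutral) (auto simp: d_def)
    then show "f h * d h h + (\<Sum>k\<in>{..h} - {h}. f k * d k h) = f h * d h h"
      by simp
  qed auto
  also have "f h * d h h = q ^ h"
  proof -
    have "qpoch (q\<^sup>2) (q\<^sup>2) (2 * h) \<noteq> 0"
      using nz' by (intro qpoch_self_nonzero) auto
    then show ?thesis
      using odd_root_qpoch_square[OF root] by (simp add: f_def d_def bailey_kernel_def mult_2)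
  qed
  also have "(\<Sum>r<h. A r * (\<Sum>k\<le>h. f k * d k r)) = (\<Sum>r<h. A r * ((1 + q ^ (2 * r + 1)) * q ^ r))"
  proof (intro sum.cong refl)
    fix r assume "r \<in> {..<h}"
    then have r: "r < h"
      by simp
    have pw: "(q\<^sup>2) ^ (2 * r + 1) = q ^ (4 * r + 2)"
      unfolding power_mult[symmetric] by (rule arg_cong[where f = "power q"]) simp
    have "(\<Sum>k\<le>h. f k * d k r) = (1 - q ^ (4 * r + 2)) * (\<Sum>k\<le>h. f k * bailey_kernel 1 (q\<^sup>2) k r)"
      unfolding sum_distrib_left
    proof (intro sum.cong refl)
      fix k assume "k \<in> {..h}"
      then have "d k r = (1 - q ^ (4 * r + 2)) * bailey_kernel 1 (q\<^sup>2) k r"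
        unfolding d_def pw[symmetric] using q0 nz' r by (intro bailey_kernel_combine) auto
      then show "f k * d k r = (1 - q ^ (4 * r + 2)) * (f k * bailey_kernel 1 (q\<^sup>2) k r)"
        by simp
    qed
    \<comment> \<open>The second factor is absorbed by the conjugate sequence; the first pairs
      \<open>r\<close> with \<open>2 * h - r\<close>.\<close>
    also have "1 - q ^ (4 * r + 2) = (1 + q ^ (2 * r + 1)) * (1 - q ^ (2 * r + 1))"
      unfolding pw[symmetric] by (simp add: algebra_simps power2_eq_square flip: power_mult_distrib power_add)
    finally have "(\<Sum>k\<le>h. f k * d k r) = (1 + q ^ (2 * r + 1)) *
        ((1 - q ^ (2 * r + 1)) * (\<Sum>k\<le>h. f k * bailey_kernel 1 (q\<^sup>2) k r))"
      by (simp only: mult.assoc)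
    also have "(1 - q ^ (2 * r + 1)) * (\<Sum>k\<le>h. f k * bailey_kernel 1 (q\<^sup>2) k r) = q ^ r"
      unfolding f_def by (rule conjugate_bailey_phi) (use q0 root nz r in auto)
    finally show "A r * (\<Sum>k\<le>h. f k * d k r) = A r * ((1 + q ^ (2 * r + 1)) * q ^ r)"
      by simp
  qed
  also have "\<dots> + A h * q ^ h = (\<Sum>r<h. (-1) ^ r * s ^ (r * (3 * r + 1)) +
      (-1) ^ (2 * h - r) * s ^ ((2 * h - r) * (3 * (2 * h - r) + 1))) + (-1) ^ h * s ^ (h * (3 * h + 1))"
  proof -
    have t: "A r * q ^ r = (-1) ^ r * s ^ (r * (3 * r + 1))" for r
      using power_pentagonal_sqrt[of s r] q0 unfolding A_def s(2) q_def[symmetric] by simp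
    have "A r * ((1 + q ^ (2 * r + 1)) * q ^ r) = (-1) ^ r * s ^ (r * (3 * r + 1)) +
      (-1) ^ (2 * h - r) * s ^ ((2 * h - r) * (3 * (2 * h - r) + 1))" if "r < h" for r
    proof -
      have "A r * ((1 + q ^ (2 * r + 1)) * q ^ r) = A r * q ^ r * (1 + q ^ (2 * r + 1))"
        by (simp add: mult_ac)
      moreover have "(-1 :: complex) ^ (2 * h - r) = (-1) ^ r"
        using that by (simp add: minus_one_power_iff)
      moreover have "s ^ ((2 * h - r) * (3 * (2 * h - r) + 1)) = s ^ (r * (3 * r + 1)) * q ^ (2 * r + 1)"
        using pentagonal_power_reflect[OF s(1), of r] that unfolding s(2) q_def[symmetric] by simp
      ultimately show ?thesis
        unfolding t by (simp add: algebra_simps)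
    qed
    with t[of h] show ?thesis
      by simp
  qed
  finally show ?thesis
    unfolding pentagonal_sum_def sum_fold_middle by simp
qed

lemma mock_mu_eq_pentagonal_sum:
  assumes q: "primitive_root (2 * h + 1) q"
  shows "\<exists>C. C \<noteq> 0 \<and> mock_mu q = C * pentagonal_sum (2 * h + 1) (inverse q)"
proof -
  define n where "n = 2 * h + 1"
  have odd: "odd n"
    by (simp add: n_def)
  have q0: "q \<noteq> 0"
    using primitive_root_nonzero[OF q] .
  have root: "q ^ (2 * h + 1) = 1"
    using q by (simp add: primitive_root_def)
  have nz: "q ^ j \<noteq> 1" if "0 < j" "j \<le> 2 * h" for j
    using q that by (simp add: primitive_root_def)
  obtain s where s: "primitive_root n s" "s\<^sup>2 = q"
    using primitive_root_sqrt[OF q] unfolding n_def by auto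
  have s0: "s \<noteq> 0"
    using primitive_root_nonzero[OF s(1)] .
  define f where "f k = (-1) ^ k * qpoch q (q\<^sup>2) k" for k
  define A where "A r = q ^ (r * (3 * r + 1) div 2) * theta_partial q r" for r
  define d where "d k r = bailey_kernel 0 q k r - q ^ (2 * r + 1) * bailey_kernel 0 q k (Suc r)" for k r
  define \<gamma> where "\<gamma> r = (\<Sum>k\<le>h. f k * bailey_kernel 0 q k r)" for r
  \<comment> \<open>Continues the summand beyond \<open>h\<close>: the power reflects with the
    factor \<open>q ^ (2 * r + 1)\<close>, the theta sum is reflected by \<open>min\<close>, as in
    \<open>sum_theta_window\<close>.\<close>
  define u where "u r = (-1) ^ r * s ^ (r * (3 * r + 1)) * theta_partial q (min r (2 * h - r))" for r
  have \<gamma>: "\<gamma> r = (-1) ^ r * \<gamma> 0" if "r \<le> h" for r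
    using that
  proof (induction r)
    case (Suc r)
    have "\<gamma> (Suc r) = - \<gamma> r"
      unfolding \<gamma>_def f_def by (rule conjugate_bailey_mu) (use q0 root nz Suc in auto)
    with Suc show ?case
      by simp
  qed simp
  \<comment> \<open>At the last index one term survives, and it is visibly nonzero; the sign rule
    carries this back to \<open>\<gamma> 0\<close> without evaluating that sum.\<close>
  have "\<gamma> h = f h * bailey_kernel 0 q h h"
  proof -
    have "(\<Sum>k\<in>{..h} - {h}. f k * bailey_kernel 0 q k h) = 0"
      by (rule sum.neutral) auto
    then show ?thesis
      unfolding \<gamma>_def by (subst sum.remove[of _ h]) auto
  qed
  also have "\<dots> \<noteq> 0"
  proof -
    have "qpoch q q (2 * h) \<noteq> 0"
      using nz by (intro qpoch_self_nonzero) auto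
    moreover have "qpoch q (q\<^sup>2) h \<noteq> 0"
    proof -
      have "q * (q\<^sup>2) ^ j \<noteq> 1" if "j < h" for j
        using nz[of "Suc (2 * j)"] that by (simp add: power_mult)
      then show ?thesis
        by (simp add: qpoch_eq_0_iff)
    qed
    ultimately show ?thesis
      by (simp add: f_def bailey_kernel_def mult_2)
  qed
  finally have \<gamma>0: "\<gamma> 0 \<noteq> 0"
    using \<gamma>[of h] by auto
  have "mock_mu q = (\<Sum>k<n. (-1) ^ k * qpoch q (q\<^sup>2) k / qpoch (-q) q k)"
    using mock_theta_at_odd_root(2)[of n q] q odd by (simp add: n_def)
  also have "\<dots> = (\<Sum>k\<le>h. (-1) ^ k * qpoch q (q\<^sup>2) k / qpoch (-q) q k)"
  proof (rule sum.mono_neutral_right)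
    have "q * (q\<^sup>2) ^ h = 1"
      using root by (simp add: power_mult)
    then have "qpoch q (q\<^sup>2) k = 0" if "h < k" for k
      using that by (auto simp: qpoch_eq_0_iff)
    then show "\<forall>k\<in>{..<n} - {..h}. (-1) ^ k * qpoch q (q\<^sup>2) k / qpoch (-q) q k = 0"
      by auto
  qed (auto simp: n_def)
  also have "\<dots> = (\<Sum>k\<le>h. f k * (\<Sum>r\<le>k. A r * d k r))"
  proof (intro sum.cong refl)
    fix k assume k: "k \<in> {..h}"
    have "(\<Sum>r\<le>k. A r * d k r) = 1 / qpoch (-q) q k"
      unfolding A_def d_def
      by (rule bailey_pair_mu)
         (use q0 nz k odd_root_power_neq_minus_1[OF odd] q in \<open>auto simp: n_def\<close>)
    then show "(-1) ^ k * qpoch q (q\<^sup>2) k / qpoch (-q) q k = f k * (\<Sum>r\<le>k. A r * d k r)"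
      by (simp add: f_def)
  qed
  also have "\<dots> = (\<Sum>r\<le>h. A r * (\<Sum>k\<le>h. f k * d k r))"
    by (rule sum_triangle_swap) (simp add: d_def)
  also have "\<dots> = (\<Sum>r\<le>h. A r * (\<gamma> r - q ^ (2 * r + 1) * \<gamma> (Suc r)))"
    by (simp add: \<gamma>_def d_def sum_distrib_left algebra_simps sum_subtractf)
  \<comment> \<open>The sign rule stops at \<open>h\<close>, since
    \<open>\<gamma> (Suc h) = 0\<close>; hence the middle index is counted once.\<close>
  also have "\<dots> = (\<Sum>r<h. A r * (\<gamma> r - q ^ (2 * r + 1) * \<gamma> (Suc r))) + A h * \<gamma> h"
  proof -
    have "\<gamma> (Suc h) = 0"
      by (simp add: \<gamma>_def)
    then show ?thesis
      by (simp add: lessThan_Suc_atMost[symmetric])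
  qed
  also have "\<dots> = (\<Sum>r<h. \<gamma> 0 * (u r + u (2 * h - r))) + \<gamma> 0 * u h"
  proof -
    have t: "q ^ (r * (3 * r + 1) div 2) = s ^ (r * (3 * r + 1))" for r
      using power_pentagonal_sqrt[of s r] unfolding s(2) .
    have "A r * (\<gamma> r - q ^ (2 * r + 1) * \<gamma> (Suc r)) = \<gamma> 0 * (u r + u (2 * h - r))" if "r < h" for r
    proof -
      have "(-1 :: complex) ^ (2 * h - r) = (-1) ^ r"
        using that by (simp add: minus_one_power_iff)
      moreover have "s ^ ((2 * h - r) * (3 * (2 * h - r) + 1)) = s ^ (r * (3 * r + 1)) * q ^ (2 * r + 1)"
        using pentagonal_power_reflect[OF s(1)[unfolded n_def], of r] that unfolding s(2) by simp
      moreover have "min r (2 * h - r) = r" "min (2 * h - r) (2 * h - (2 * h - r)) = r"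
        using that by auto
      moreover have "\<gamma> r = (-1) ^ r * \<gamma> 0" "\<gamma> (Suc r) = - ((-1) ^ r * \<gamma> 0)"
        using \<gamma>[of r] \<gamma>[of "Suc r"] that by auto
      ultimately show ?thesis
        unfolding A_def t u_def by (simp only:) (simp add: algebra_simps)
    qed
    moreover have "A h * \<gamma> h = \<gamma> 0 * u h"
      using \<gamma>[of h] unfolding A_def t u_def by simp
    ultimately show ?thesis
      by simp
  qed
  also have "\<dots> = \<gamma> 0 * (\<Sum>r<n. u r)"
    unfolding n_def sum_fold_middle by (simp add: sum_distrib_left distrib_left)
  also have "(\<Sum>r<n. u r) = (\<Sum>r<n. \<Sum>l<n. (-1) powi int l *
      s powi ((int r + 2 * int l)\<^sup>2 + (int r + 2 * int l)) * inverse q ^ (l * (3 * l + 1)))"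
  proof (intro sum.cong refl)
    fix r assume r: "r \<in> {..<n}"
    have "u r = (\<Sum>l<n. (-1) ^ r * s ^ (r * (3 * r + 1)) *
        ((-1) powi (int l - int r) * q powi (- (int l - int r)\<^sup>2)))"
      unfolding u_def n_def using sum_theta_window[OF q, of r] r
      by (simp only: n_def sum_distrib_left[symmetric]) (simp add: n_def)
    also have "\<dots> = (\<Sum>l<n. (-1) powi int l *
      s powi ((int r + 2 * int l)\<^sup>2 + (int r + 2 * int l)) * inverse q ^ (l * (3 * l + 1)))"
    proof (intro sum.cong refl)
      fix l
      have sgn: "(-1 :: complex) ^ r * (-1) powi (int l - int r) = (-1) powi int l"
        by (auto simp: minus_one_powi_eq minus_one_power_iff)
      have q_powi: "q powi x = s powi (2 * x)" for x
        by (simp add: s(2) power_int_mult)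
      have "inverse q ^ (l * (3 * l + 1)) = q powi (- int (l * (3 * l + 1)))"
        by (simp only: power_int_minus power_int_of_nat power_inverse)
      moreover have "s ^ (r * (3 * r + 1)) = s powi int (r * (3 * r + 1))"
        by (simp only: power_int_of_nat)
      \<comment> \<open>Completing the square in \<open>r\<close>: for fixed \<open>l\<close> the
        shift by \<open>2 * l\<close> disappears in a sum over a full period, which separates the
        two variables.\<close>
      moreover have "int (r * (3 * r + 1)) + 2 * (- (int l - int r)\<^sup>2) =
          ((int r + 2 * int l)\<^sup>2 + (int r + 2 * int l)) + 2 * (- int (l * (3 * l + 1)))"
        by (simp add: power2_eq_square algebra_simps)
      ultimately have "s ^ (r * (3 * r + 1)) * q powi (- (int l - int r)\<^sup>2) =
          s powi ((int r + 2 * int l)\<^sup>2 + (int r + 2 * int l)) * inverse q ^ (l * (3 * l + 1))"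
        unfolding q_powi using s0 by (metis power_int_add)
      then show "(-1) ^ r * s ^ (r * (3 * r + 1)) *
          ((-1) powi (int l - int r) * q powi (- (int l - int r)\<^sup>2)) =
        (-1) powi int l * s powi ((int r + 2 * int l)\<^sup>2 + (int r + 2 * int l)) * inverse q ^ (l * (3 * l + 1))"
        unfolding sgn[symmetric] by (simp add: mult_ac)
    qed
    finally show "u r = (\<Sum>l<n. (-1) powi int l *
      s powi ((int r + 2 * int l)\<^sup>2 + (int r + 2 * int l)) * inverse q ^ (l * (3 * l + 1)))" .
  qed
  also have "\<dots> = (\<Sum>l<n. (-1) powi int l * inverse q ^ (l * (3 * l + 1)) *
      (\<Sum>r<n. s powi ((int r + 2 * int l)\<^sup>2 + (int r + 2 * int l))))"
    by (subst sum.swap) (simp add: sum_distrib_left mult_ac)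
  also have "\<dots> = (\<Sum>l<n. (-1) powi int l * inverse q ^ (l * (3 * l + 1)) *
      (\<Sum>r<n. s powi ((int r)\<^sup>2 + 1 * int r)))"
  proof -
    have "(\<Sum>r<n. s powi ((int r + c)\<^sup>2 + (int r + c))) = (\<Sum>r<n. s powi ((int r)\<^sup>2 + int r))" for c
    proof (rule sum_periodic_shift[where f = "\<lambda>x. s powi (x\<^sup>2 + x)"])
      fix x
      have "(x + int n)\<^sup>2 + (x + int n) - (x\<^sup>2 + x) = int n * (2 * x + int n + 1)"
        by (simp add: power2_eq_square algebra_simps)
      then show "s powi ((x + int n)\<^sup>2 + (x + int n)) = s powi (x\<^sup>2 + x)"
        by (intro primitive_root_powi_cong[OF s(1)]) simp
    qed
    then show ?thesis
      by simp
  qed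
  also have "\<dots> = (\<Sum>r<n. s powi ((int r)\<^sup>2 + 1 * int r)) * pentagonal_sum n (inverse q)"
    by (simp add: pentagonal_sum_def sum_distrib_left mult_ac)
  finally show ?thesis
    using \<gamma>0 gauss_sum_nonzero[OF s(1) odd, of 1]
    by (intro exI[of _ "\<gamma> 0 * (\<Sum>r<n. s powi ((int r)\<^sup>2 + 1 * int r))"]) (simp add: n_def)
qed

section \<open>Triangular exponents and the double sum for \<open>\<sigma>\<close>\<close>

lemma triangular_eq_choose: "(k + 2) choose 2 = Suc k * Suc (Suc k) div 2"
  by (simp add: choose_two mult.commute)

text \<open>The indices \<open>i\<close> and \<open>-1 - i\<close> give the same triangular number
  and have opposite parity. So the indices congruent to \<open>r + 1\<close> modulo 2 between
  \<open>- r - 1\<close> and \<open>r - 1\<close> represent each triangular number of index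
  \<open>0, ..., r\<close> once. This parity makes the exponents in the double sum integral
  quadratic polynomials.\<close>

lemma inverse_triangular_partial_eq:
  assumes "q \<noteq> 0"
  shows "inverse_triangular_partial q r =
         (\<Sum>k = 1..int r + 1. q powi (- ((int r + 1 - 2 * k) * (int r + 1 - 2 * k + 1) div 2)))"
proof -
  define u where "u i = q powi (- (i * (i + 1) div 2))" for i :: int
  have sym: "u (- 1 - i) = u i" for i
    by (simp add: u_def algebra_simps)
  have u_nat: "1 / q ^ (m * Suc m div 2) = u (int m)" for m
  proof -
    have "int m * (int m + 1) div 2 = int (m * Suc m div 2)"
      by (simp add: zdiv_int algebra_simps)
    then show ?thesis
      unfolding u_def by (simp only: power_int_minus power_int_of_nat inverse_eq_divide)
  qed
  have "inverse_triangular_partial q r = (\<Sum>k = 1..int r + 1. u (int r + 1 - 2 * k))"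
  proof (induction r)
    case 0
    then show ?case
      using sym[of 0] u_nat[of 0] by (simp add: inverse_triangular_partial_def)
  next
    case (Suc r)
    have "(\<Sum>k = 1..int (Suc r) + 1. u (int (Suc r) + 1 - 2 * k)) =
        (\<Sum>k = 0..int r + 1. u (int r + 1 - 2 * k))"
    proof (rule sum.reindex_bij_witness[where i = "\<lambda>k. int r + 2 - k" and j = "\<lambda>k. int r + 2 - k"])
      fix k
      show "u (int r + 1 - 2 * (int r + 2 - k)) = u (int (Suc r) + 1 - 2 * k)"
        using sym[of "int (Suc r) + 1 - 2 * k"] by (simp add: algebra_simps)
    qed auto
    also have "{0..int r + 1} = insert 0 {1..int r + 1}"
      by auto
    also have "(\<Sum>k\<in>insert 0 {1..int r + 1}. u (int r + 1 - 2 * k)) =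
        u (int r + 1) + (\<Sum>k = 1..int r + 1. u (int r + 1 - 2 * k))"
      by (subst sum.insert) auto
    also have "\<dots> = inverse_triangular_partial q (Suc r)"
      using u_nat[of "Suc r"] by (simp add: inverse_triangular_partial_def flip: Suc)
         (simp add: add.commute)
    finally show ?case ..
  qed
  then show ?thesis
    by (simp add: u_def)
qed

text \<open>The region \<open>a + b < n\<close> of the square is covered by \<open>(k, m - k)\<close>, the region \<open>a + b \<ge> n\<close>
  by \<open>(n - m + k, n - k)\<close>.\<close>

lemma sum_square_two_triangles:
  fixes H :: "int \<Rightarrow> int \<Rightarrow> complex"
  shows "(\<Sum>m = 1..n. \<Sum>k = 1..m. H (n - m + k) (n - k)) + (\<Sum>m = 1..n - 1. \<Sum>k = 1..m. H k (m - k)) =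
         (\<Sum>a = 1..n. \<Sum>b = 0..n - 1. H a b)"
proof -
  define S where "S = {1..n} \<times> {0..n - 1}"
  have 1: "(\<Sum>m = 1..n. \<Sum>k = 1..m. H (n - m + k) (n - k)) = (\<Sum>(a, b)\<in>{p \<in> S. fst p + snd p \<ge> n}. H a b)"
    unfolding sum.Sigma[OF finite_atLeastAtMost_int ballI[OF finite_atLeastAtMost_int]]
    by (rule sum.reindex_bij_witness[where i = "\<lambda>(a, b). (2 * n - a - b, n - b)"
          and j = "\<lambda>(m, k). (n - m + k, n - k)"]) (auto simp: S_def)
  have 2: "(\<Sum>m = 1..n - 1. \<Sum>k = 1..m. H k (m - k)) = (\<Sum>(a, b)\<in>{p \<in> S. fst p + snd p < n}. H a b)"
    unfolding sum.Sigma[OF finite_atLeastAtMost_int ballI[OF finite_atLeastAtMost_int]]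
    by (rule sum.reindex_bij_witness[where i = "\<lambda>(a, b). (a + b, a)"
          and j = "\<lambda>(m, k). (k, m - k)"]) (auto simp: S_def)
  have "(\<Sum>(a, b)\<in>S. H a b) =
      (\<Sum>(a, b)\<in>{p \<in> S. fst p + snd p \<ge> n}. H a b) + (\<Sum>(a, b)\<in>{p \<in> S. fst p + snd p < n}. H a b)"
    by (subst sum.union_disjoint[symmetric]) (auto simp: S_def intro!: sum.cong)
  then show ?thesis
    unfolding 1 2 by (simp add: S_def sum.cartesian_product)
qed

lemma mock_sigma_eq_pentagonal_sum:
  assumes odd: "odd n" and \<zeta>: "primitive_root n \<zeta>"
  shows "\<exists>C. C \<noteq> 0 \<and> mock_sigma (-\<zeta>) = C * pentagonal_sum n (inverse \<zeta>)"
proof -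
  define q where "q = -\<zeta>"
  obtain n' where n': "n = Suc n'"
    using odd by (cases n) auto
  have \<zeta>0: "\<zeta> \<noteq> 0"
    using primitive_root_nonzero[OF \<zeta>] .
  have q0: "q \<noteq> 0"
    using \<zeta>0 by (simp add: q_def)
  \<comment> \<open>As \<open>n\<close> is odd, \<open>-\<zeta>\<close> has order
    \<open>2 * n\<close>, so all kernel denominators below stay nonzero.\<close>
  have nz: "q ^ j \<noteq> 1" if "0 < j" "j < 2 * n" for j
  proof
    assume qj: "q ^ j = 1"
    have "(q ^ j)\<^sup>2 = (q\<^sup>2) ^ j"
      by (simp add: mult.commute flip: power_mult)
    then have "\<zeta> ^ (2 * j) = (q ^ j)\<^sup>2"
      unfolding power_mult q_def by simp
    then have "n dvd 2 * j"
      using qj primitive_root_power_eq_1_iff[OF \<zeta>] by simp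
    then have "n dvd j"
      using odd by (metis coprime_dvd_mult_right_iff coprime_right_2_iff_odd)
    then have "j = n"
      using that by (auto elim!: dvdE)
    then show False
      using qj odd \<zeta> by (simp add: q_def primitive_root_def)
  qed
  have zero: "qpoch (-q) q n = 0"
    using numerator_zero(2)[OF odd \<zeta>, of n] by (simp add: q_def)
  define f where "f k = qpoch (-q) q k * q ^ (k * Suc k div 2)" for k
  define V where "V = inverse_triangular_partial q"
  define A where "A r = (-1) ^ r * q ^ (r\<^sup>2 + 2 * r) * V r" for r
  define d where "d k r = bailey_kernel 1 q k r / q ^ r - q ^ (r + 2) * bailey_kernel 1 q k (Suc r)" for k r
  define \<gamma> where "\<gamma> r = (\<Sum>k\<le>n'. f k * bailey_kernel 1 q k r)" for r
  have \<gamma>: "\<gamma> r = q ^ (r * Suc r div 2) * \<gamma> 0" if "r \<le> n'" for r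
    using that
  proof (induction r)
    case (Suc r)
    have "\<gamma> (Suc r) = q ^ Suc r * \<gamma> r"
      unfolding \<gamma>_def f_def lessThan_Suc_atMost[symmetric] n'[symmetric]
      by (rule conjugate_bailey_sigma) (use q0 zero nz Suc n' in auto)
    with Suc show ?case
      unfolding triangular_Suc power_add by simp
  qed simp
  have "\<gamma> n' = f n' * bailey_kernel 1 q n' n'"
  proof -
    have "(\<Sum>k\<in>{..n'} - {n'}. f k * bailey_kernel 1 q k n') = 0"
      by (rule sum.neutral) auto
    then show ?thesis
      unfolding \<gamma>_def by (subst sum.remove[of _ n']) auto
  qed
  also have "\<dots> \<noteq> 0"
  proof -
    have "qpoch q q (2 * n' + 1) \<noteq> 0"
      using nz n' by (intro qpoch_self_nonzero) auto
    moreover have "qpoch (-q) q n' \<noteq> 0"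
    proof -
      have "- q * q ^ j \<noteq> 1" if "j < n'" for j
      proof
        assume "- q * q ^ j = 1"
        then have "q ^ Suc j = -1"
          by (metis minus_equation_iff mult_minus_left power_Suc)
        then have "q ^ (2 * Suc j) = 1"
          unfolding mult.commute[of 2] power_mult by simp
        then show False
          using nz[of "2 * Suc j"] that n' by simp
      qed
      then show ?thesis
        by (simp add: qpoch_eq_0_iff)
    qed
    ultimately show ?thesis
      using q0 by (simp add: f_def bailey_kernel_def mult_2)
  qed
  finally have \<gamma>0: "\<gamma> 0 \<noteq> 0"
    using \<gamma>[of n'] by auto
  have half: "2 * int (r * Suc r div 2) = int r * (int r + 1)" for r
  proof -
    have "2 * (r * Suc r div 2) = r * Suc r"
      by simp
    then have "int (2 * (r * Suc r div 2)) = int (r * Suc r)"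
      by (simp only:)
    then show ?thesis
      by (simp only: of_nat_mult of_nat_numeral of_nat_Suc add.commute)
  qed
  have half': "2 * (x * (x + 1) div 2) = x * (x + 1)" for x :: int
    by simp
  have q_powi: "q powi x = (-1) powi x * \<zeta> powi x" for x
    by (simp add: q_def flip: power_int_mult_distrib)
  have qA: "q * A r = (-1) ^ r * q powi ((int r + 1)\<^sup>2) *
      (\<Sum>k = 1..int r + 1. q powi (- ((int r + 1 - 2 * k) * (int r + 1 - 2 * k + 1) div 2)))" for r
  proof -
    have "q powi ((int r + 1)\<^sup>2) = q ^ ((Suc r)\<^sup>2)"
      by (metis of_nat_Suc of_nat_power power_int_of_nat add.commute)
    also have "(Suc r)\<^sup>2 = Suc (r\<^sup>2 + 2 * r)"
      by (simp add: power2_eq_square)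
    finally show ?thesis
      by (simp add: A_def V_def inverse_triangular_partial_eq[OF q0])
  qed
  have combine: "\<epsilon> * q powi a * (\<Sum>k\<in>S. q powi (- y k)) * (q ^ t * g) =
      g * (\<Sum>k\<in>S. \<epsilon> * q powi (a + int t - y k))" for \<epsilon> g a y t and S :: "int set"
  proof -
    have "q powi (a + int t - y k) = q powi a * q ^ t * q powi (- y k)" for k
      using q0 by (simp add: power_int_diff power_int_add power_int_minus divide_inverse)
    then show ?thesis
      by (simp add: sum_distrib_left sum_distrib_right mult_ac)
  qed
  have "mock_sigma (-\<zeta>) = (\<Sum>k\<le>n'. q ^ ((k + 2) choose 2) * qpoch (-q) q k / qpoch q (q\<^sup>2) (k + 1))"
    using mock_theta_at_odd_root(3)[OF odd \<zeta>] unfolding n' lessThan_Suc_atMost q_def by simp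
  also have "\<dots> = (\<Sum>k\<le>n'. (q * f k * q ^ k) * (\<Sum>r\<le>k. A r * d k r))"
  proof (intro sum.cong refl)
    fix k assume k: "k \<in> {..n'}"
    have "(\<Sum>r\<le>k. A r * d k r) = 1 / qpoch q (q\<^sup>2) (Suc k)"
      unfolding A_def d_def V_def
      by (rule bailey_pair_sigma) (use q0 nz k n' in auto)
    moreover have "q ^ ((k + 2) choose 2) = q ^ (k * Suc k div 2) * q ^ k * q"
      unfolding triangular_eq_choose triangular_Suc by (simp add: power_add)
    ultimately show "q ^ ((k + 2) choose 2) * qpoch (-q) q k / qpoch q (q\<^sup>2) (k + 1) =
        (q * f k * q ^ k) * (\<Sum>r\<le>k. A r * d k r)"
      by (simp add: f_def)
  qed
  also have "\<dots> = (\<Sum>r\<le>n'. A r * (\<Sum>k\<le>n'. (q * f k * q ^ k) * d k r))"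
    by (rule sum_triangle_swap) (simp add: d_def)
  also have "\<dots> = (\<Sum>r\<le>n'. A r * (q * (\<gamma> r - \<gamma> (Suc r))))"
  proof (intro sum.cong refl arg_cong2[where f = "(*)"])
    fix r
    have "(q * f k * q ^ k) * d k r = q * (f k * bailey_kernel 1 q k r - f k * bailey_kernel 1 q k (Suc r))"
      if "k \<le> n'" for k
    proof -
      have "q ^ k * d k r = bailey_kernel 1 q k r - bailey_kernel 1 q k (Suc r)"
      proof (cases "r \<le> k")
        case True
        have "bailey_kernel 1 q k (Suc r) * (1 - q ^ k * q ^ r * q ^ Suc 1) =
            bailey_kernel 1 q k r * (1 - q ^ k / q ^ r)"
          by (rule bailey_kernel_Suc_right) (use True q0 nz n' that in auto)
        then show ?thesis
          unfolding d_def using q0 by (simp add: power_add power2_eq_square algebra_simps)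
      qed (simp add: d_def)
      then have "q * f k * (q ^ k * d k r) = q * f k * (bailey_kernel 1 q k r - bailey_kernel 1 q k (Suc r))"
        by simp
      then show ?thesis
        by (simp add: algebra_simps)
    qed
    then show "(\<Sum>k\<le>n'. (q * f k * q ^ k) * d k r) = q * (\<gamma> r - \<gamma> (Suc r))"
      unfolding \<gamma>_def sum_subtractf[symmetric] sum_distrib_left by (intro sum.cong) auto
  qed
  also have "\<dots> = (\<Sum>r\<le>n'. q * A r * \<gamma> r) + (\<Sum>r<n'. - q * A r * \<gamma> (Suc r))"
  proof -
    have "\<gamma> (Suc n') = 0"
      by (simp add: \<gamma>_def)
    then show ?thesis
      by (simp add: lessThan_Suc_atMost[symmetric] algebra_simps sum_subtractf sum_negf)
  qed
  \<comment> \<open>With \<open>m = r + 1\<close> the exponent agrees modulo \<open>n\<close> with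
    \<open>b\<^sup>2 + 4 a b + a\<^sup>2 + a\<close> at \<open>a = n - m + k\<close>,
    \<open>b = n - k\<close>. The other sum has the same form at \<open>a = k\<close>,
    \<open>b = m - k\<close>, and the two regions fill a square.\<close>
  also have "(\<Sum>r\<le>n'. q * A r * \<gamma> r) =
      \<gamma> 0 * (\<Sum>m = 1..int n. \<Sum>k = 1..m. (-1) powi (int n - m + k) * \<zeta> powi ((int n - k)\<^sup>2 +
        4 * (int n - m + k) * (int n - k) + (int n - m + k)\<^sup>2 + (int n - m + k)))"
    unfolding sum_distrib_left[of "\<gamma> 0" _ "{1..int n}"]
  proof (rule sum.reindex_bij_witness[where i = "\<lambda>m. nat (m - 1)" and j = "\<lambda>r. int r + 1"])
    fix r assume r: "r \<in> {..n'}"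
    have "(-1) ^ r * q powi ((int r + 1)\<^sup>2 + int (r * Suc r div 2) -
          (int r + 1 - 2 * k) * (int r + 1 - 2 * k + 1) div 2) =
        (-1) powi (int n - (int r + 1) + k) * \<zeta> powi ((int n - k)\<^sup>2 +
        4 * (int n - (int r + 1) + k) * (int n - k) + (int n - (int r + 1) + k)\<^sup>2 + (int n - (int r + 1) + k))"
      for k
    proof -
      define m where "m = int r + 1"
      have e: "m\<^sup>2 + int (r * Suc r div 2) - (m - 2 * k) * (m - 2 * k + 1) div 2 =
          m\<^sup>2 - m + 2 * m * k - 2 * k\<^sup>2 + k" (is "_ = ?e")
      proof -
        define x where "x = int (r * Suc r div 2)"
        define y where "y = (m - 2 * k) * (m - 2 * k + 1) div 2"
        have "2 * x = int r * (int r + 1)" "2 * y = (m - 2 * k) * (m - 2 * k + 1)"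
          using half[of r] half'[of "m - 2 * k"] by (simp_all only: x_def y_def)
        then show ?thesis
          unfolding x_def[symmetric] y_def[symmetric] by (simp add: m_def power2_eq_square algebra_simps)
      qed
      have "(-1 :: complex) ^ r * (-1) powi ?e = (-1) powi (int n - m + k)"
        using odd by (auto simp: minus_one_powi_eq minus_one_power_iff m_def power2_eq_square)
      moreover have "\<zeta> powi ?e = \<zeta> powi ((int n - k)\<^sup>2 +
          4 * (int n - m + k) * (int n - k) + (int n - m + k)\<^sup>2 + (int n - m + k))"
      proof (rule primitive_root_powi_cong[OF \<zeta>])
        have "?e - ((int n - k)\<^sup>2 + 4 * (int n - m + k) * (int n - k) + (int n - m + k)\<^sup>2 + (int n - m + k)) =
            int n * (- 6 * int n + 6 * m - 1)"
          by (simp add: power2_eq_square algebra_simps)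
        then show "int n dvd ?e - ((int n - k)\<^sup>2 +
          4 * (int n - m + k) * (int n - k) + (int n - m + k)\<^sup>2 + (int n - m + k))"
          by simp
      qed
      ultimately show ?thesis
        unfolding m_def[symmetric] e q_powi by (simp flip: mult.assoc)
    qed
    moreover have "q * A r * \<gamma> r = \<gamma> 0 * (\<Sum>k = 1..int r + 1. (-1) ^ r *
        q powi ((int r + 1)\<^sup>2 + int (r * Suc r div 2) - (int r + 1 - 2 * k) * (int r + 1 - 2 * k + 1) div 2))"
    proof -
      have "\<gamma> r = q ^ (r * Suc r div 2) * \<gamma> 0"
        using \<gamma>[of r] r by simp
      then show ?thesis
        unfolding qA combine[symmetric] by simp
    qed
    ultimately show "\<gamma> 0 * (\<Sum>k = 1..int r + 1. (-1) powi (int n - (int r + 1) + k) * \<zeta> powi ((int n - k)\<^sup>2 +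
        4 * (int n - (int r + 1) + k) * (int n - k) + (int n - (int r + 1) + k)\<^sup>2 + (int n - (int r + 1) + k))) =
        q * A r * \<gamma> r"
      by simp
  qed (auto simp: n')
  also have "(\<Sum>r<n'. - q * A r * \<gamma> (Suc r)) =
      \<gamma> 0 * (\<Sum>m = 1..int n - 1. \<Sum>k = 1..m. (-1) powi k * \<zeta> powi ((m - k)\<^sup>2 +
        4 * k * (m - k) + k\<^sup>2 + k))"
    unfolding sum_distrib_left[of "\<gamma> 0" _ "{1..int n - 1}"]
  proof (rule sum.reindex_bij_witness[where i = "\<lambda>m. nat (m - 1)" and j = "\<lambda>r. int r + 1"])
    fix r assume r: "r \<in> {..<n'}"
    have "- ((-1) ^ r * q powi ((int r + 1)\<^sup>2 + int (Suc r * Suc (Suc r) div 2) -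
          (int r + 1 - 2 * k) * (int r + 1 - 2 * k + 1) div 2)) =
        (-1) powi k * \<zeta> powi ((int r + 1 - k)\<^sup>2 + 4 * k * (int r + 1 - k) + k\<^sup>2 + k)" for k
    proof -
      define m where "m = int r + 1"
      have e: "m\<^sup>2 + int (Suc r * Suc (Suc r) div 2) - (m - 2 * k) * (m - 2 * k + 1) div 2 =
          (m - k)\<^sup>2 + 4 * k * (m - k) + k\<^sup>2 + k" (is "_ = ?e")
      proof -
        define x where "x = int (Suc r * Suc (Suc r) div 2)"
        define y where "y = (m - 2 * k) * (m - 2 * k + 1) div 2"
        have "2 * x = int (Suc r) * (int (Suc r) + 1)" "2 * y = (m - 2 * k) * (m - 2 * k + 1)"
          using half[of "Suc r"] half'[of "m - 2 * k"] by (simp_all only: x_def y_def)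
        then show ?thesis
          unfolding x_def[symmetric] y_def[symmetric] by (simp add: m_def power2_eq_square algebra_simps)
      qed
      have sg: "- ((-1 :: complex) ^ r * (-1) powi ?e) = (-1) powi k"
        by (auto simp: minus_one_powi_eq minus_one_power_iff m_def power2_eq_square)
      show ?thesis
        unfolding m_def[symmetric] e q_powi sg[symmetric] by (simp only: mult_minus_left mult.assoc)
    qed
    moreover have "- q * A r * \<gamma> (Suc r) = \<gamma> 0 * (\<Sum>k = 1..int r + 1. - ((-1) ^ r *
        q powi ((int r + 1)\<^sup>2 + int (Suc r * Suc (Suc r) div 2) - (int r + 1 - 2 * k) * (int r + 1 - 2 * k + 1) div 2)))"
    proof -
      have "\<gamma> (Suc r) = q ^ (Suc r * Suc (Suc r) div 2) * \<gamma> 0"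
        using \<gamma>[of "Suc r"] r by simp
      then show ?thesis
        unfolding sum_negf mult_minus_left mult_minus_right qA combine[symmetric] by (simp only:)
    qed
    ultimately show "\<gamma> 0 * (\<Sum>k = 1..int r + 1. (-1) powi k * \<zeta> powi ((int r + 1 - k)\<^sup>2 +
        4 * k * (int r + 1 - k) + k\<^sup>2 + k)) = - q * A r * \<gamma> (Suc r)"
      by simp
  qed (auto simp: n')
  also have "\<gamma> 0 * (\<Sum>m = 1..int n. \<Sum>k = 1..m. (-1) powi (int n - m + k) * \<zeta> powi ((int n - k)\<^sup>2 +
        4 * (int n - m + k) * (int n - k) + (int n - m + k)\<^sup>2 + (int n - m + k))) +
      \<gamma> 0 * (\<Sum>m = 1..int n - 1. \<Sum>k = 1..m. (-1) powi k * \<zeta> powi ((m - k)\<^sup>2 +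
        4 * k * (m - k) + k\<^sup>2 + k)) =
      \<gamma> 0 * (\<Sum>a = 1..int n. \<Sum>b = 0..int n - 1. (-1) powi a * \<zeta> powi (b\<^sup>2 + 4 * a * b + a\<^sup>2 + a))"
    unfolding distrib_left[symmetric]
      sum_square_two_triangles[of "\<lambda>a b. (-1) powi a * \<zeta> powi (b\<^sup>2 + 4 * a * b + a\<^sup>2 + a)"] ..
  also have "(\<Sum>a = 1..int n. \<Sum>b = 0..int n - 1. (-1) powi a * \<zeta> powi (b\<^sup>2 + 4 * a * b + a\<^sup>2 + a)) =
      (\<Sum>a = 1..int n. (-1) powi a * \<zeta> powi (a - 3 * a\<^sup>2) * (\<Sum>b<n. \<zeta> powi ((int b)\<^sup>2 + 0 * int b)))"
  proof (intro sum.cong refl)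
    fix a :: int
    have "(\<Sum>b = 0..int n - 1. (-1) powi a * \<zeta> powi (b\<^sup>2 + 4 * a * b + a\<^sup>2 + a)) =
        (\<Sum>b<n. (-1) powi a * \<zeta> powi ((int b)\<^sup>2 + 4 * a * int b + a\<^sup>2 + a))"
      by (rule sum.reindex_bij_witness[where i = int and j = nat]) auto
    also have "\<dots> = (\<Sum>b<n. (-1) powi a * \<zeta> powi (a - 3 * a\<^sup>2) * \<zeta> powi ((int b + 2 * a)\<^sup>2))"
    proof (intro sum.cong refl)
      fix b
      have "(int b)\<^sup>2 + 4 * a * int b + a\<^sup>2 + a = (a - 3 * a\<^sup>2) + (int b + 2 * a)\<^sup>2"
        by (simp add: power2_eq_square algebra_simps)
      then show "(-1) powi a * \<zeta> powi ((int b)\<^sup>2 + 4 * a * int b + a\<^sup>2 + a) =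
          (-1) powi a * \<zeta> powi (a - 3 * a\<^sup>2) * \<zeta> powi ((int b + 2 * a)\<^sup>2)"
        using \<zeta>0 by (simp only:) (simp add: power_int_add)
    qed
    also have "\<dots> = (-1) powi a * \<zeta> powi (a - 3 * a\<^sup>2) * (\<Sum>b<n. \<zeta> powi ((int b + 2 * a)\<^sup>2))"
      by (simp add: sum_distrib_left)
    also have "(\<Sum>b<n. \<zeta> powi ((int b + 2 * a)\<^sup>2)) = (\<Sum>b<n. \<zeta> powi ((int b)\<^sup>2))"
    proof (rule sum_periodic_shift[where f = "\<lambda>x. \<zeta> powi (x\<^sup>2)"])
      fix x
      have "(x + int n)\<^sup>2 - x\<^sup>2 = int n * (2 * x + int n)"
        by (simp add: power2_eq_square algebra_simps)
      then show "\<zeta> powi ((x + int n)\<^sup>2) = \<zeta> powi (x\<^sup>2)"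
        by (intro primitive_root_powi_cong[OF \<zeta>]) simp
    qed
    finally show "(\<Sum>b = 0..int n - 1. (-1) powi a * \<zeta> powi (b\<^sup>2 + 4 * a * b + a\<^sup>2 + a)) =
        (-1) powi a * \<zeta> powi (a - 3 * a\<^sup>2) * (\<Sum>b<n. \<zeta> powi ((int b)\<^sup>2 + 0 * int b))"
      by simp
  qed
  also have "\<dots> = (\<Sum>a = 1..int n. (-1) powi a * \<zeta> powi (a - 3 * a\<^sup>2)) * (\<Sum>b<n. \<zeta> powi ((int b)\<^sup>2 + 0 * int b))"
    by (simp add: sum_distrib_right)
  also have "(\<Sum>a = 1..int n. (-1) powi a * \<zeta> powi (a - 3 * a\<^sup>2)) = - pentagonal_sum n (inverse \<zeta>)"
  proof -
    have "(\<Sum>a = 1..int n. (-1) powi a * \<zeta> powi (a - 3 * a\<^sup>2)) =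
        (\<Sum>k<n. - ((-1) ^ k * inverse \<zeta> ^ (k * (3 * k + 1))))"
    proof (rule sum.reindex_bij_witness[where i = "\<lambda>k. int n - int k" and j = "\<lambda>a. nat (int n - a)"])
      fix a assume a: "a \<in> {1..int n}"
      define k where "k = nat (int n - a)"
      have k: "a = int n - int k"
        using a by (simp add: k_def)
      have "(-1 :: complex) powi a = - ((-1) ^ k)"
        using odd by (auto simp: k minus_one_powi_eq minus_one_power_iff)
      moreover have "\<zeta> powi (a - 3 * a\<^sup>2) = \<zeta> powi (- int (k * (3 * k + 1)))"
      proof (rule primitive_root_powi_cong[OF \<zeta>])
        have "a - 3 * a\<^sup>2 - - int (k * (3 * k + 1)) = int n * (1 - 3 * int n + 6 * int k)"
          by (simp add: k power2_eq_square algebra_simps)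
        then show "int n dvd a - 3 * a\<^sup>2 - - int (k * (3 * k + 1))"
          by simp
      qed
      moreover have "\<dots> = inverse \<zeta> ^ (k * (3 * k + 1))"
        by (simp only: power_int_minus power_int_of_nat power_inverse)
      ultimately show "- ((-1) ^ nat (int n - a) * inverse \<zeta> ^ (nat (int n - a) * (3 * nat (int n - a) + 1))) =
          (-1) powi a * \<zeta> powi (a - 3 * a\<^sup>2)"
        unfolding k_def[symmetric] by simp
    qed auto
    then show ?thesis
      by (simp add: pentagonal_sum_def sum_negf)
  qed
  finally show ?thesis
    using \<gamma>0 gauss_sum_nonzero[OF \<zeta> odd, of 0]
    by (intro exI[of _ "- (\<gamma> 0 * (\<Sum>b<n. \<zeta> powi ((int b)\<^sup>2 + 0 * int b)))"]) simp
qed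

section \<open>Galois conjugates of roots of unity\<close>

text \<open>Values at \<open>z\<close> stand for the elements of the ring of integer polynomials in
  \<open>z\<close>, so that congruences in it are obtained from polynomial identities.\<close>

definition ipoly :: "int poly \<Rightarrow> complex \<Rightarrow> complex" where
  "ipoly f z = poly (map_poly of_int f) z"

lemma ipoly_0 [simp]: "ipoly 0 z = 0"
  by (simp add: ipoly_def)

lemma ipoly_pCons [simp]: "ipoly (pCons a f) z = of_int a + z * ipoly f z"
  by (simp add: ipoly_def map_poly_pCons)

lemma ipoly_1 [simp]: "ipoly 1 z = 1"
  unfolding one_pCons by simp

lemma ipoly_add [simp]: "ipoly (f + g) z = ipoly f z + ipoly g z"
  by (induction f g rule: poly_induct2) (simp_all add: algebra_simps)

lemma ipoly_smult [simp]: "ipoly (smult c f) z = of_int c * ipoly f z"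
  by (induction f) (simp_all add: algebra_simps)

lemma ipoly_uminus [simp]: "ipoly (- f) z = - ipoly f z"
  by (induction f) simp_all

lemma ipoly_diff [simp]: "ipoly (f - g) z = ipoly f z - ipoly g z"
  using ipoly_add[of f "- g" z] by simp

lemma ipoly_mult [simp]: "ipoly (f * g) z = ipoly f z * ipoly g z"
  by (induction f) (simp_all add: algebra_simps)

lemma ipoly_power [simp]: "ipoly (f ^ k) z = ipoly f z ^ k"
  by (induction k) simp_all

lemma ipoly_monom [simp]: "ipoly (monom c k) z = of_int c * z ^ k"
  by (induction k) (simp_all add: monom_0 monom_Suc)

lemma ipoly_sum [simp]: "ipoly (\<Sum>x\<in>A. f x) z = (\<Sum>x\<in>A. ipoly (f x) z)"
  by (induction A rule: infinite_finite_induct) simp_all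

lemma ipoly_pcompose [simp]: "ipoly (pcompose f g) z = ipoly f (ipoly g z)"
  by (induction f) (simp_all add: pcompose_pCons)

section \<open>The Frobenius congruence modulo a prime\<close>

lemma prime_dvd_add_power_diff:
  fixes u v :: "'a :: comm_ring_1"
  assumes p: "prime p"
  shows "of_nat p dvd (u + v) ^ p - (u ^ p + v ^ p)"
proof -
  have p0: "0 < p"
    using p by (simp add: prime_gt_0_nat)
  have "(u + v) ^ p = (\<Sum>k\<le>p. of_nat (p choose k) * u ^ k * v ^ (p - k))"
    by (rule binomial_ring)
  also have "{..p} = insert 0 (insert p {0<..<p})"
    using p0 by auto
  also have "(\<Sum>k\<in>\<dots>. of_nat (p choose k) * u ^ k * v ^ (p - k)) =
      v ^ p + (u ^ p + (\<Sum>k\<in>{0<..<p}. of_nat (p choose k) * u ^ k * v ^ (p - k)))"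
    using p0 by simp
  finally have "(u + v) ^ p - (u ^ p + v ^ p) = (\<Sum>k\<in>{0<..<p}. of_nat (p choose k) * u ^ k * v ^ (p - k))"
    by simp
  also have "of_nat p dvd \<dots>"
  proof (rule dvd_sum)
    fix k assume "k \<in> {0<..<p}"
    then have "p dvd p choose k"
      using p by (intro dvd_choose_prime) auto
    then have "(of_nat p :: 'a) dvd of_nat (p choose k)"
      by (auto elim!: dvdE)
    then show "(of_nat p :: 'a) dvd of_nat (p choose k) * u ^ k * v ^ (p - k)"
      by (simp add: dvd_mult2 mult.assoc)
  qed
  finally show ?thesis .
qed

lemma fermat_int:
  fixes c :: int
  assumes p: "prime p"
  shows "int p dvd c ^ p - c"
proof (induction c rule: int_induct[where k = 0])
  case base
  then show ?case
    using p by (simp add: power_0_left prime_gt_0_nat)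
next
  case (step1 i)
  have "int p dvd ((i + 1) ^ p - (i ^ p + 1 ^ p)) + (i ^ p - i)"
    using prime_dvd_add_power_diff[OF p, of i 1] step1 by (intro dvd_add) auto
  then show ?case
    by (simp add: algebra_simps)
next
  case (step2 i)
  have "int p dvd (i ^ p - i) - (((i - 1) + 1) ^ p - ((i - 1) ^ p + 1 ^ p))"
    using prime_dvd_add_power_diff[OF p, of "i - 1" 1] by (intro dvd_diff[OF step2(2)])
  then show ?case
    by (simp add: algebra_simps)
qed

text \<open>Coefficient by coefficient: raising to the \<open>p\<close>-th power is additive modulo
  \<open>p\<close>, and on constants it is the identity by Fermat.\<close>

lemma frobenius_int_poly:
  fixes f :: "int poly"
  assumes p: "prime p"
  shows "of_nat p dvd f ^ p - pcompose f (monom 1 p)"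
proof (induction f)
  case 0
  then show ?case
    using p by (simp add: power_0_left prime_gt_0_nat)
next
  case (pCons a f)
  obtain t where t: "a ^ p - a = int p * t"
    using fermat_int[OF p, of a] by (auto elim!: dvdE)
  have 1: "(of_nat p :: int poly) dvd ([:a:] + monom 1 1 * f) ^ p - ([:a:] ^ p + (monom 1 1 * f) ^ p)"
    by (rule prime_dvd_add_power_diff[OF p])
  have "[:a:] ^ p - [:a:] = of_nat p * [:t:]"
    using t by (simp add: poly_const_pow of_nat_poly)
  then have 2: "(of_nat p :: int poly) dvd [:a:] ^ p - [:a:]"
    by (metis dvd_triv_left)
  have 3: "(of_nat p :: int poly) dvd monom 1 p * (f ^ p - pcompose f (monom 1 p))"
    using pCons by (intro dvd_mult)
  have "pCons a f = [:a:] + monom 1 1 * f"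
    by (simp add: monom_Suc monom_0)
  moreover have "(monom 1 1 * f) ^ p = monom 1 p * f ^ p"
    by (simp add: power_mult_distrib monom_power)
  moreover have "pcompose (pCons a f) (monom 1 p) = [:a:] + monom 1 p * pcompose f (monom 1 p)"
    by (simp add: pcompose_pCons)
  ultimately have "pCons a f ^ p - pcompose (pCons a f) (monom 1 p) =
      (([:a:] + monom 1 1 * f) ^ p - ([:a:] ^ p + (monom 1 1 * f) ^ p)) + ([:a:] ^ p - [:a:])
      + monom 1 p * (f ^ p - pcompose f (monom 1 p))"
    by (simp add: algebra_simps)
  then show ?case
    using 1 2 3 by (metis dvd_add)
qed

text \<open>A minimal polynomial normalised by content 1 rather than by its leading coefficient,
  which is what Gauss's lemma needs. It is meaningful only for algebraic \<open>z\<close>, as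
  assumed in the context below.\<close>

definition min_ipoly :: "complex \<Rightarrow> int poly" where
  "min_ipoly z = primitive_part (ARG_MIN degree f. f \<noteq> 0 \<and> ipoly f z = 0)"

context
  fixes z :: complex and f0 :: "int poly"
  assumes f0: "f0 \<noteq> 0" "ipoly f0 z = 0"
begin

lemma min_ipoly: "content (min_ipoly z) = 1" "ipoly (min_ipoly z) z = 0"
  and min_ipoly_degree_le: "\<And>f. f \<noteq> 0 \<Longrightarrow> ipoly f z = 0 \<Longrightarrow> degree (min_ipoly z) \<le> degree f"
proof -
  define g where "g = (ARG_MIN degree f. f \<noteq> 0 \<and> ipoly f z = 0)"
  have g: "g \<noteq> 0" "ipoly g z = 0"
    using arg_min_natI[of "\<lambda>f. f \<noteq> 0 \<and> ipoly f z = 0" f0 degree] f0 by (auto simp: g_def)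
  have g_le: "degree g \<le> degree f" if "f \<noteq> 0" "ipoly f z = 0" for f
    unfolding g_def by (rule arg_min_nat_le) (use that in auto)
  have eq: "min_ipoly z = primitive_part g"
    by (simp add: min_ipoly_def g_def)
  show "content (min_ipoly z) = 1"
    using g by (simp add: eq)
  have "of_int (content g) * ipoly (primitive_part g) z = 0"
    using g(2) by (metis content_times_primitive_part ipoly_smult)
  then show "ipoly (min_ipoly z) z = 0"
    using g(1) by (simp add: eq)
  show "degree (min_ipoly z) \<le> degree f" if "f \<noteq> 0" "ipoly f z = 0" for f
    using g_le[OF that] by (simp add: eq)
qed

text \<open>The remainder of pseudo-division is zero by minimality of the degree. This gives
  divisibility over the fraction field, and Gauss's lemma brings it back to the integers.\<close>

lemma min_ipoly_dvd:
  assumes "ipoly f z = 0"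
  shows "min_ipoly z dvd f"
proof -
  define g where "g = min_ipoly z"
  have g0: "g \<noteq> 0"
    using min_ipoly(1) by (auto simp: g_def)
  obtain a q where aq: "a \<noteq> 0" "smult a f = g * q + pseudo_mod f g"
    using pseudo_mod(1)[OF g0] by blast
  have "ipoly (smult a f) z = ipoly (g * q + pseudo_mod f g) z"
    by (simp only: aq(2))
  then have "ipoly (pseudo_mod f g) z = 0"
    using assms min_ipoly(2) by (simp add: g_def)
  then have "pseudo_mod f g = 0"
    using pseudo_mod(2)[OF g0, of f] min_ipoly_degree_le by (force simp: g_def)
  with aq have "smult a f = g * q"
    by simp
  then have "smult (to_fract a) (fract_poly f) = fract_poly g * fract_poly q"
    by (metis fract_poly_mult fract_poly_smult)
  then have "fract_poly g dvd smult (to_fract a) (fract_poly f)"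
    by simp
  then have "fract_poly g dvd fract_poly f"
    using aq(1) by (simp add: dvd_smult_iff)
  then show ?thesis
    unfolding g_def using min_ipoly(1) by (rule fract_poly_dvdD)
qed

lemma min_ipoly_degree_pos: "0 < degree (min_ipoly z)"
proof (rule ccontr)
  assume "\<not> 0 < degree (min_ipoly z)"
  then have "degree (min_ipoly z) = 0"
    by simp
  then obtain c where c: "min_ipoly z = [:c:]"
    by (rule degree_eq_zeroE)
  then show False
    using min_ipoly by auto
qed

end

text \<open>An integer \<open>p > 1\<close> is not a unit in the ring generated by a root of unity.
  The minimal polynomial \<open>g\<close> divides \<open>x ^ n - 1\<close>, hence has leading
  coefficient 1 or -1 and positive degree; it therefore cannot divide 1 modulo
  \<open>p\<close>.\<close>

lemma ipoly_int_multiple_neq_1: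
  assumes p: "1 < p" and root: "z ^ n = 1" "0 < n"
  shows "of_int p * ipoly t z \<noteq> 1"
proof
  assume eq: "of_int p * ipoly t z = 1"
  define f0 :: "int poly" where "f0 = monom 1 n - 1"
  have "coeff f0 n = 1"
    using root(2) by (simp add: f0_def)
  then have "f0 \<noteq> 0"
    by auto
  moreover have "ipoly f0 z = 0"
    using root(1) by (simp add: f0_def)
  ultimately have f0: "f0 \<noteq> 0" "ipoly f0 z = 0"
    by auto
  define g where "g = min_ipoly z"
  obtain h where h: "f0 = g * h"
    using min_ipoly_dvd[OF f0 f0(2)] by (auto simp: g_def elim: dvdE)
  have "lead_coeff f0 = 1"
  proof -
    have "degree f0 \<le> n"
      unfolding f0_def by (intro degree_diff_le) (auto simp: degree_monom_eq)
    moreover have "n \<le> degree f0"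
      using \<open>coeff f0 n = 1\<close> by (intro le_degree) simp
    ultimately show ?thesis
      using \<open>coeff f0 n = 1\<close> by simp
  qed
  then have lc: "lead_coeff g dvd 1"
    using h by (metis dvd_triv_left lead_coeff_mult)
  have root_t: "ipoly (1 - smult p t) z = 0"
    using eq by simp
  obtain r where r: "1 - smult p t = g * r"
    using min_ipoly_dvd[OF f0 root_t] unfolding g_def by (elim dvdE)
  \<comment> \<open>Reducing the cofactor to coefficients in \<open>0, ..., p - 1\<close> ensures
    that a nonzero leading coefficient is not divisible by \<open>p\<close>.\<close>
  define r0 where "r0 = map_poly (\<lambda>c. c mod p) r"
  define r1 where "r1 = map_poly (\<lambda>c. c div p) r"
  have "r = r0 + smult p r1"
    by (rule poly_eqI) (simp add: r0_def r1_def coeff_map_poly)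
  with r have r': "1 - smult p (t + g * r1) = g * r0"
    by (simp add: algebra_simps smult_add_right)
  show False
  proof (cases "r0 = 0")
    case True
    have "coeff (1 - smult p (t + g * r1)) 0 = 0"
      unfolding r' True by simp
    then have "p * coeff (t + g * r1) 0 = 1"
      by simp
    then show False
      using p by (metis dvd_triv_left zdvd_not_zless zero_less_one)
  next
    case False
    define d where "d = degree g + degree r0"
    have "0 < d"
      using min_ipoly_degree_pos[OF f0] by (simp add: d_def g_def)
    then have "coeff (1 - smult p (t + g * r1)) d = - (p * coeff (t + g * r1) d)"
      by simp
    then have "p dvd coeff (g * r0) d"
      unfolding r' by simp
    moreover have "coeff (g * r0) d = lead_coeff g * lead_coeff r0"
      by (simp add: d_def coeff_mult_degree_sum)
    ultimately have "p dvd lead_coeff g * lead_coeff r0"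
      by simp
    then have "p dvd lead_coeff r0"
      using lc by (metis dvd_mult_unit_iff' mult.commute)
    moreover have "lead_coeff r0 = coeff r (degree r0) mod p"
      by (simp add: r0_def coeff_map_poly)
    ultimately have "lead_coeff r0 = 0"
      by (metis dvd_imp_mod_0 mod_mod_trivial)
    with False show False
      by simp
  qed
qed

section \<open>Conjugation by exponents prime to the order\<close>

lemma primitive_root_power:
  assumes "primitive_root n \<zeta>" "coprime a n"
  shows "primitive_root n (\<zeta> ^ a)"
proof -
  have "(\<zeta> ^ a) ^ m = 1 \<longleftrightarrow> n dvd m" for m
    using primitive_root_power_eq_1_iff[OF assms(1), of "a * m"] assms(2)
    by (simp add: power_mult coprime_dvd_mult_right_iff coprime_commute)
  then show ?thesis
    using assms(1) by (auto simp: primitive_root_def dest: nat_dvd_not_less)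
qed

text \<open>Dedekind's argument. Write \<open>x ^ n - 1 = g h\<close> with \<open>g\<close> minimal
  for \<open>z\<close>. If \<open>g\<close> did not vanish at \<open>z ^ p\<close>, then
  \<open>h\<close> would, while Frobenius makes the value of \<open>g\<close> at
  \<open>z ^ p\<close> a multiple of \<open>p\<close>; the derivative then shows that
  \<open>n\<close> is a multiple of \<open>p\<close> in the ring generated by
  \<open>z\<close>.\<close>

lemma ipoly_prime_power_root:
  assumes z: "primitive_root n z" and p: "prime p" "\<not> p dvd n" and f: "ipoly f z = 0"
  shows "ipoly f (z ^ p) = 0"
proof -
  define f0 :: "int poly" where "f0 = monom 1 n - 1"
  have n: "0 < n" "z ^ n = 1"
    using z by (auto simp: primitive_root_def)
  have "coeff f0 n = 1"
    using n by (simp add: f0_def)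
  then have "f0 \<noteq> 0"
    by auto
  moreover have "ipoly f0 z = 0"
    using n by (simp add: f0_def)
  ultimately have f0: "f0 \<noteq> 0" "ipoly f0 z = 0"
    by auto
  define g where "g = min_ipoly z"
  obtain h where h: "f0 = g * h"
    using min_ipoly_dvd[OF f0 f0(2)] by (auto simp: g_def elim: dvdE)
  obtain k where k: "f = g * k"
    using min_ipoly_dvd[OF f0 f] by (auto simp: g_def elim: dvdE)
  have "ipoly g (z ^ p) = 0"
  proof (rule ccontr)
    assume ne: "ipoly g (z ^ p) \<noteq> 0"
    have zp: "(z ^ p) ^ n = 1"
      using n by (metis mult.commute power_mult power_one)
    then have "ipoly f0 (z ^ p) = 0"
      by (simp add: f0_def)
    then have h0: "ipoly h (z ^ p) = 0"
      using ne by (simp add: h)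
    obtain s where s: "g ^ p - pcompose g (monom 1 p) = of_nat p * s"
      using frobenius_int_poly[OF p(1), of g] by (auto elim: dvdE)
    have "ipoly (g ^ p - pcompose g (monom 1 p)) z = ipoly (smult (int p) s) z"
      unfolding s by (simp add: of_nat_poly)
    moreover have "ipoly g z ^ p = 0"
      using min_ipoly(2)[OF f0] p(1) by (simp add: g_def power_0_left prime_gt_0_nat)
    ultimately have "- ipoly g (z ^ p) = of_int (int p) * ipoly s z"
      by simp
    then have gp: "ipoly g (z ^ p) = of_int (- int p) * ipoly s z"
      by (metis add.inverse_inverse mult_minus_left of_int_minus)
    have "pderiv f0 = monom (int n) (n - 1)"
      by (simp add: f0_def pderiv_diff pderiv_monom)
    then have "monom (int n) (n - 1) = g * pderiv h + h * pderiv g"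
      by (simp add: h pderiv_mult)
    then have "ipoly (monom (int n) (n - 1)) (z ^ p) = ipoly (g * pderiv h + h * pderiv g) (z ^ p)"
      by simp
    then have "of_nat n * (z ^ p) ^ (n - 1) = of_int (- int p) * ipoly s z * ipoly (pderiv h) (z ^ p)"
      by (simp add: h0 gp)
    then have "of_nat n * ((z ^ p) ^ (n - 1) * z ^ p) =
        of_int (- int p) * ipoly s z * ipoly (pderiv h) (z ^ p) * z ^ p"
      by (simp only: mult.assoc[symmetric])
    moreover have "(z ^ p) ^ (n - 1) * z ^ p = 1"
      using zp n(1) by (simp flip: power_Suc2)
    ultimately have nt: "of_nat n = of_int (int p) * ipoly (- (s * pcompose (pderiv h) (monom 1 p) * monom 1 p)) z"
      by simp
    have "coprime p n"
      using p by (rule prime_imp_coprime)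
    then have "coprime (int n) (int p)"
      by (simp add: coprime_commute)
    \<comment> \<open>As \<open>n\<close> is prime to \<open>p\<close>, Bezout turns divisibility of
      \<open>n\<close> by \<open>p\<close> into invertibility of \<open>p\<close>.\<close>
    then obtain u v where uv: "u * int n + v * int p = 1"
      by (metis bezout_int coprime_imp_gcd_eq_1)
    define t where "t = smult u (- (s * pcompose (pderiv h) (monom 1 p) * monom 1 p)) + [:v:]"
    have "of_int (int p) * ipoly t z = of_int u * of_nat n + of_int v * of_int (int p)"
      unfolding nt t_def by (simp add: algebra_simps)
    also have "\<dots> = of_int (u * int n + v * int p)"
      by simp
    also have "\<dots> = 1"
      by (simp only: uv of_int_1)
    finally show False
      using ipoly_int_multiple_neq_1[of "int p" z n t] n p(1) prime_gt_1_nat by auto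
  qed
  then show ?thesis
    by (simp add: k)
qed

text \<open>Prime factors of \<open>a\<close> are split off one at a time; each leaves
  \<open>z ^ p\<close> primitive of the same order.\<close>

lemma ipoly_galois:
  assumes "primitive_root n z" "coprime a n" "0 < a" "ipoly f z = 0"
  shows "ipoly f (z ^ a) = 0"
  using assms
proof (induction a arbitrary: z rule: less_induct)
  case (less a)
  show ?case
  proof (cases "a = 1")
    case True
    with less.prems show ?thesis
      by simp
  next
    case False
    then obtain p where p: "prime p" "p dvd a"
      using prime_factor_nat by blast
    then obtain b where b: "a = p * b"
      by (auto elim: dvdE)
    have "coprime p n" "coprime b n" "0 < b" "b < a"
      using less.prems b p(1) prime_gt_1_nat[OF p(1)] by auto
    moreover have "\<not> p dvd n"
      using \<open>coprime p n\<close> p(1) by (metis coprime_common_divisor dvd_refl not_prime_unit)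
    ultimately have "ipoly f ((z ^ p) ^ b) = 0"
      using less.prems p(1) by (intro less.IH ipoly_prime_power_root primitive_root_power) auto
    then show ?thesis
      by (simp add: b power_mult)
  qed
qed

section \<open>Nonvanishing of the pentagonal sums\<close>

lemma pentagonal_sum_eq_ipoly:
  "pentagonal_sum n s = ipoly (\<Sum>k<n. monom ((-1) ^ k) (k * (3 * k + 1))) s"
  by (simp add: pentagonal_sum_def)

lemma pentagonal_sum_galois:
  assumes "primitive_root n s" "coprime a n" "0 < a" "pentagonal_sum n s = 0"
  shows "pentagonal_sum n (s ^ a) = 0"
  using assms ipoly_galois unfolding pentagonal_sum_eq_ipoly by blast

lemma prime_dvd_one_minus_power_diff:
  fixes x :: "'a :: comm_ring_1"
  assumes p: "prime p" "odd p"
  shows "of_nat p dvd (1 - x) ^ (p ^ a) - (1 - x ^ (p ^ a))"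
proof (induction a)
  case (Suc a)
  define y where "y = x ^ (p ^ a)"
  obtain w where w: "(1 - x) ^ (p ^ a) - (1 - y) = of_nat p * w"
    using Suc by (auto simp: y_def elim: dvdE)
  have "of_nat p dvd ((1 - y) + of_nat p * w) ^ p - ((1 - y) ^ p + (of_nat p * w) ^ p)"
    by (rule prime_dvd_add_power_diff[OF p(1)])
  moreover have "of_nat p dvd (1 + - y) ^ p - (1 ^ p + (- y) ^ p)"
    by (rule prime_dvd_add_power_diff[OF p(1)])
  moreover have "of_nat p dvd (of_nat p * w) ^ p"
    using p(1) by (simp add: power_mult_distrib dvd_mult2 dvd_power prime_gt_0_nat)
  ultimately have "of_nat p dvd (((1 - y) + of_nat p * w) ^ p - ((1 - y) ^ p + (of_nat p * w) ^ p))
      + ((1 + - y) ^ p - (1 ^ p + (- y) ^ p)) + (of_nat p * w) ^ p"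
    by (intro dvd_add)
  moreover have "(1 - x) ^ (p ^ Suc a) = ((1 - y) + of_nat p * w) ^ p"
    unfolding w[symmetric] by (simp add: mult.commute flip: power_mult)
  moreover have "x ^ (p ^ Suc a) = y ^ p"
    by (simp add: y_def mult.commute flip: power_mult)
  ultimately show ?case
    using p(2) by (simp add: algebra_simps)
qed simp

text \<open>At \<open>s = 1\<close> the sum is alternating with an odd number of terms, hence 1. If
  it vanished at \<open>s\<close>, then \<open>1 - s\<close> would be a unit; but
  \<open>(1 - s) ^ (p ^ a)\<close> is a multiple of \<open>p\<close>, because
  \<open>s ^ (p ^ a) = 1\<close>.\<close>

lemma pentagonal_sum_prime_power_nonzero:
  assumes p: "prime p" "odd p" and s: "primitive_root (p ^ a) s"
  shows "pentagonal_sum (p ^ a) s \<noteq> 0"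
proof
  assume zero: "pentagonal_sum (p ^ a) s = 0"
  define f :: "int poly" where "f = (\<Sum>k<p ^ a. monom ((-1) ^ k) (k * (3 * k + 1)))"
  have alt: "(\<Sum>k<m. (-1 :: int) ^ k) = (if odd m then 1 else 0)" for m :: nat
    by (induction m) auto
  have "poly (f - 1) 1 = 0"
    using p(2) by (simp add: f_def poly_sum poly_monom alt)
  then obtain r where r: "f - 1 = [:-1, 1:] * r"
    unfolding poly_eq_0_iff_dvd by (auto elim: dvdE)
  have "ipoly (f - 1) s = (s - 1) * ipoly r s"
    unfolding r by (simp add: algebra_simps)
  then have unit: "(1 - s) * ipoly r s = 1"
    using zero by (simp add: pentagonal_sum_eq_ipoly f_def algebra_simps)
  obtain t :: "int poly" where t: "(1 - monom 1 1) ^ (p ^ a) - (1 - monom 1 1 ^ (p ^ a)) = of_nat p * t"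
    using prime_dvd_one_minus_power_diff[OF p, of "monom 1 1 :: int poly" a] by (auto elim: dvdE)
  have "ipoly ((1 - monom 1 1) ^ (p ^ a) - (1 - monom 1 1 ^ (p ^ a))) s = of_int (int p) * ipoly t s"
    unfolding t by (simp add: of_nat_poly)
  then have "(1 - s) ^ (p ^ a) = of_int (int p) * ipoly t s"
    using s by (simp add: primitive_root_def)
  moreover have "(1 - s) ^ (p ^ a) * ipoly r s ^ (p ^ a) = 1"
    using unit by (simp flip: power_mult_distrib)
  ultimately have "of_int (int p) * ipoly (t * r ^ (p ^ a)) s = 1"
    by (simp add: mult.assoc)
  moreover have "1 < int p"
    using prime_gt_1_nat[OF p(1)] by simp
  moreover have "s ^ (p ^ a) = 1" "0 < p ^ a"
    using s by (auto simp: primitive_root_def)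
  ultimately show False
    using ipoly_int_multiple_neq_1 by blast
qed

text \<open>A shift of the index by the odd period \<open>m\<close> preserves the power and reverses
  the sign, so adjacent blocks cancel and an odd number of them leaves one.\<close>

lemma pentagonal_sum_collapse:
  assumes s: "s ^ m = 1" and "odd m" "odd c"
  shows "pentagonal_sum (c * m) s = pentagonal_sum m s"
proof -
  define f where "f k = (-1) ^ k * s ^ (k * (3 * k + 1))" for k
  have shift: "f (i * m + k) = (-1) ^ i * f k" for i k
  proof -
    have "(i * m + k) * (3 * (i * m + k) + 1) = k * (3 * k + 1) + m * (i * (3 * i * m + 6 * k + 1))"
      by (simp add: algebra_simps)
    then have "s ^ ((i * m + k) * (3 * (i * m + k) + 1)) = s ^ (k * (3 * k + 1))"
      using s by (simp only: power_add power_mult power_one mult_1_right)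
    moreover have "(-1 :: complex) ^ (i * m + k) = (-1) ^ i * (-1) ^ k"
      using assms(2) by (simp add: power_add minus_one_power_iff)
    ultimately show ?thesis
      by (simp add: f_def)
  qed
  have "(\<Sum>k<i * m. f k) = (if odd i then \<Sum>k<m. f k else 0)" for i
  proof (induction i)
    case (Suc i)
    have "{..<Suc i * m} = {..<i * m} \<union> {i * m..<i * m + m}"
      by auto
    then have "(\<Sum>k<Suc i * m. f k) = (\<Sum>k<i * m. f k) + (\<Sum>k = i * m..<i * m + m. f k)"
      by (simp add: sum.union_disjoint ivl_disj_int)
    also have "(\<Sum>k = i * m..<i * m + m. f k) = (\<Sum>k<m. f (i * m + k))"
      by (rule sum.reindex_bij_witness[where i = "\<lambda>k. i * m + k" and j = "\<lambda>k. k - i * m"]) auto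
    also have "\<dots> = (-1) ^ i * (\<Sum>k<m. f k)"
      by (simp add: shift sum_distrib_left)
    finally show ?case
      using Suc by (auto simp: minus_one_power_iff)
  qed simp
  then show ?thesis
    using assms(3) by (simp add: pentagonal_sum_def f_def)
qed

section \<open>Residues of \<open>k (3 k + 1)\<close> and the descent at a prime factor\<close>

lemma prime_ge_5_mod_3:
  fixes p :: nat
  assumes "prime p" "5 \<le> p"
  shows "p mod 3 \<noteq> 0"
proof
  assume "p mod 3 = 0"
  then have "3 dvd p"
    by auto
  then have "3 = p"
    using assms(1) by (auto simp: prime_nat_iff)
  then show False
    using assms(2) by simp
qed

text \<open>The polynomial has two distinct roots modulo \<open>p\<close>, namely 0 and the root of
  \<open>3 k + 1\<close>. A self-map of a finite set that is not injective is not
  surjective.\<close>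

lemma pentagonal_residue_missed:
  assumes p: "prime p" "5 \<le> p"
  obtains e where "e < p" "\<And>k. k * (3 * k + 1) mod p \<noteq> (e :: nat)"
proof -
  define E where "E k = k * (3 * k + 1) mod p" for k :: nat
  have "p mod 3 \<noteq> 0"
    using prime_ge_5_mod_3[OF p] .
  then obtain k1 where k1: "0 < k1" "k1 < p" "p dvd 3 * k1 + 1"
  proof -
    consider "p mod 3 = 1" | "p mod 3 = 2"
      using \<open>p mod 3 \<noteq> 0\<close> by linarith
    then show ?thesis
    proof cases
      case 1
      then have "3 * ((p - 1) div 3) + 1 = p"
        using p(2) by presburger
      then show ?thesis
        using p(2) by (intro that[of "(p - 1) div 3"]) auto
    next
      case 2
      then have "3 * ((2 * p - 1) div 3) + 1 = 2 * p"
        using p(2) by presburger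
      then show ?thesis
        using p(2) by (intro that[of "(2 * p - 1) div 3"]) auto
    qed
  qed
  have "p dvd k1 * (3 * k1 + 1)"
    using k1(3) by (rule dvd_mult)
  then have "E k1 = 0"
    unfolding E_def by (rule dvd_imp_mod_0)
  then have "E 0 = E k1"
    by (simp add: E_def)
  then have "\<not> inj_on E {..<p}"
    using k1 by (auto simp: inj_on_def)
  then have "E ` {..<p} \<noteq> {..<p}"
    by (metis finite_lessThan eq_card_imp_inj_on)
  moreover have "E ` {..<p} \<subseteq> {..<p}"
    using p(2) by (auto simp: E_def)
  ultimately obtain e where e: "e < p" "e \<notin> E ` {..<p}"
    by blast
  have "E k = E (k mod p)" for k
    unfolding E_def by (metis (no_types, lifting) mod_add_left_eq mod_mult_cong mod_mod_trivial mod_mult_right_eq)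
  then have "E k \<noteq> e" for k
    using e p(2) by (metis imageI lessThan_iff mod_less_divisor less_le_trans zero_less_numeral)
  then show ?thesis
    using that e(1) unfolding E_def by blast
qed

text \<open>On the class that survives, \<open>k = k0 + p j\<close>, the exponent is that of
  \<open>k0\<close> plus \<open>p * p\<close> times a quadratic in \<open>j\<close>; this is the
  origin of \<open>w ^ (p * p)\<close>.\<close>

lemma pentagonal_sum_descent:
  assumes p: "prime p" "5 \<le> p" and \<eta>: "primitive_root p \<eta>" and w: "w ^ (p * (p * m)) = 1"
    and m: "odd m" and zero: "\<And>a. 0 < a \<Longrightarrow> a < p \<Longrightarrow> pentagonal_sum (p * m) (w * \<eta> ^ a) = 0"
  shows "pentagonal_sum m (w ^ (p * p)) = 0"
proof -
  define E where "E k = k * (3 * k + 1)" for k :: nat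
  have w0: "w \<noteq> 0"
    using w p(2) m by (cases "w = 0") (auto simp: power_0_left split: if_splits)
  have oddp: "odd p"
    using p prime_odd_nat by force
  obtain e0 where e0: "e0 < p" "\<And>k. E k mod p \<noteq> e0"
    using pentagonal_residue_missed[OF p] unfolding E_def by blast
  \<comment> \<open>The class of \<open>-1 / 6\<close> modulo \<open>p\<close>. The value of
    \<open>v\<close> is the inverse of \<open>p\<close> modulo 6, hence 1 or 5, and it is the linear
    coefficient of the quadratic in \<open>j\<close>.\<close>
  obtain k0 v where k0: "6 * k0 + 1 = p * v" "k0 < p" "v = 1 \<or> v = 5"
  proof -
    have "p mod 3 \<noteq> 0"
      using prime_ge_5_mod_3[OF p] .
    then have "p mod 6 = 1 \<or> p mod 6 = 5"
      using oddp by presburger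
    then show ?thesis
    proof
      assume "p mod 6 = 1"
      then have "6 * ((p - 1) div 6) + 1 = p * 1"
        using p(2) by presburger
      then show ?thesis
        using p(2) by (intro that[of "(p - 1) div 6" 1]) auto
    next
      assume "p mod 6 = 5"
      then have "6 * ((5 * p - 1) div 6) + 1 = p * 5"
        using p(2) by presburger
      then show ?thesis
        using p(2) by (intro that[of "(5 * p - 1) div 6" 5]) auto
    qed
  qed
  define e1 where "e1 = E k0 mod p"
  have e1: "e1 < p"
    using p(2) by (simp add: e1_def)
  have hit: "E k mod p = e1 \<longleftrightarrow> k mod p = k0" for k
  proof -
    have cop: "coprime (int p) 6" "coprime (int p) 12"
    proof -
      have "\<not> p dvd 3"
        using p(2) by (auto dest: dvd_imp_le)
      then have "coprime p 2" "coprime p 3"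
        using prime_imp_coprime[OF p(1)] oddp by auto
      then have "coprime p (2 * 3)" "coprime p (2 * 2 * 3)"
        unfolding coprime_mult_right_iff by blast+
      then show "coprime (int p) 6" "coprime (int p) 12"
        using coprime_int_iff[of p 6] coprime_int_iff[of p 12] by simp_all
    qed
    have "E k mod p = e1 \<longleftrightarrow> int p dvd int (E k) - int (E k0)"
      unfolding e1_def by (metis mod_eq_dvd_iff of_nat_mod of_nat_eq_iff)
    also have "\<dots> \<longleftrightarrow> int p dvd 12 * (int (E k) - int (E k0))"
      using cop(2) by (simp only: coprime_dvd_mult_right_iff)
    also have "12 * (int (E k) - int (E k0)) = (6 * int k + 1)\<^sup>2 - (int (6 * k0 + 1))\<^sup>2"
      by (simp add: E_def power2_eq_square algebra_simps)
    also have "int p dvd \<dots> \<longleftrightarrow> int p dvd (6 * int k + 1)\<^sup>2"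
    proof -
      have "int p dvd (int (6 * k0 + 1))\<^sup>2"
        unfolding k0(1) by (simp add: power2_eq_square)
      then show ?thesis
        by (rule dvd_diff_left_iff)
    qed
    also have "\<dots> \<longleftrightarrow> int p dvd 6 * int k + 1"
      using p(1) by (simp add: prime_dvd_power_iff)
    also have "\<dots> \<longleftrightarrow> int p dvd (6 * int k + 1) - int (6 * k0 + 1)"
    proof -
      have "int p dvd int (6 * k0 + 1)"
        unfolding k0(1) by simp
      then show ?thesis
        by (rule dvd_diff_left_iff[symmetric])
    qed
    also have "(6 * int k + 1) - int (6 * k0 + 1) = 6 * (int k - int k0)"
      by simp
    also have "int p dvd \<dots> \<longleftrightarrow> int p dvd int k - int k0"
      using cop(1) by (simp only: coprime_dvd_mult_right_iff)
    also have "\<dots> \<longleftrightarrow> k mod p = k0"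
      using k0(2) by (metis mod_eq_dvd_iff of_nat_mod of_nat_eq_iff mod_less)
    finally show ?thesis .
  qed
  have geo: "(\<Sum>a<p. \<eta> ^ (a * (p - e)) * \<eta> ^ (a * E k)) = (if E k mod p = e then of_nat p else 0)"
    if "e < p" for e k
  proof -
    have "(\<Sum>a<p. \<eta> ^ (a * (p - e)) * \<eta> ^ (a * E k)) = (\<Sum>a<p. (\<eta> ^ (E k + (p - e))) ^ a)"
      by (simp add: algebra_simps flip: power_add power_mult)
    also have "\<dots> = (if E k mod p = e then of_nat p else 0)"
    proof -
      have "p dvd E k + (p - e) \<longleftrightarrow> int p dvd int (E k + (p - e))"
        by (simp only: int_dvd_int_iff)
      also have "int (E k + (p - e)) = (int (E k) - int e) + int p"
        using that by (simp add: of_nat_diff)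
      also have "int p dvd \<dots> \<longleftrightarrow> int p dvd int (E k) - int e"
        by simp
      also have "\<dots> \<longleftrightarrow> E k mod p = e mod p"
        by (metis mod_eq_dvd_iff of_nat_mod of_nat_eq_iff)
      finally have iff: "\<eta> ^ (E k + (p - e)) = 1 \<longleftrightarrow> E k mod p = e"
        using that by (simp add: primitive_root_power_eq_1_iff[OF \<eta>])
      moreover have "(\<eta> ^ (E k + (p - e))) ^ p = 1"
        using \<eta> by (metis mult.commute power_mult power_one primitive_root_def)
      ultimately show ?thesis
        using root_sum_eq_0 by (cases "E k mod p = e") auto
    qed
    finally show ?thesis .
  qed
  define c where "c k = (-1) ^ k * w ^ E k" for k
  \<comment> \<open>The first weight projects to exponents congruent to \<open>e1\<close>, the
    second to the missed residue \<open>e0\<close>, where there are none. For \<open>a = 0\<close>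
    the weights cancel, so the value at \<open>w\<close> itself does not enter.\<close>
  have "0 = (\<Sum>a<p. (\<eta> ^ (a * (p - e1)) - \<eta> ^ (a * (p - e0))) * pentagonal_sum (p * m) (w * \<eta> ^ a))"
  proof (rule sym, rule sum.neutral, rule ballI)
    fix a assume "a \<in> {..<p}"
    then show "(\<eta> ^ (a * (p - e1)) - \<eta> ^ (a * (p - e0))) * pentagonal_sum (p * m) (w * \<eta> ^ a) = 0"
      using zero[of a] by (cases "a = 0") auto
  qed
  also have "\<dots> = (\<Sum>a<p. \<Sum>k<p * m. c k * (\<eta> ^ (a * (p - e1)) * \<eta> ^ (a * E k) -
      \<eta> ^ (a * (p - e0)) * \<eta> ^ (a * E k)))"
    unfolding pentagonal_sum_def sum_distrib_left c_def E_def[symmetric]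
    by (simp add: power_mult_distrib algebra_simps flip: power_mult)
  also have "\<dots> = (\<Sum>k<p * m. c k * ((\<Sum>a<p. \<eta> ^ (a * (p - e1)) * \<eta> ^ (a * E k)) -
      (\<Sum>a<p. \<eta> ^ (a * (p - e0)) * \<eta> ^ (a * E k))))"
    by (subst sum.swap) (simp add: sum_distrib_left sum_subtractf right_diff_distrib)
  also have "\<dots> = (\<Sum>k<p * m. if k mod p = k0 then of_nat p * c k else 0)"
    unfolding geo[OF e1] geo[OF e0(1)] hit using e0(2) by (intro sum.cong) auto
  also have "\<dots> = (\<Sum>k\<in>{k. k < p * m \<and> k mod p = k0}. of_nat p * c k)"
    by (rule sum.mono_neutral_cong_right) auto
  also have "\<dots> = (\<Sum>j<m. of_nat p * c (k0 + p * j))"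
  proof (rule sum.reindex_bij_witness[where i = "\<lambda>j. k0 + p * j" and j = "\<lambda>k. k div p"])
    fix j assume "j \<in> {..<m}"
    then have "p * Suc j \<le> p * m"
      by (intro mult_le_mono2) simp
    moreover have "k0 + p * j < p * Suc j"
      using k0(2) by simp
    ultimately show "k0 + p * j \<in> {k. k < p * m \<and> k mod p = k0}"
      using k0(2) by simp
  next
    fix k assume k: "k \<in> {k. k < p * m \<and> k mod p = k0}"
    then show "k div p \<in> {..<m}"
      by (simp add: less_mult_imp_div_less mult.commute)
    show "k0 + p * (k div p) = k"
      using k by auto
    then show "of_nat p * c (k0 + p * (k div p)) = of_nat p * c k"
      by simp
  qed (use k0(2) in auto)
  also have "\<dots> = of_nat p * ((-1) ^ k0 * w ^ E k0) * (\<Sum>j<m. (-1) ^ j * (w ^ (p * p)) ^ (3 * j * j + v * j))"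
    unfolding sum_distrib_left
  proof (intro sum.cong refl)
    fix j
    have "E (k0 + p * j) = E k0 + p * (3 * p * j * j) + (6 * k0 + 1) * (p * j)"
      by (simp add: E_def algebra_simps)
    also have "\<dots> = E k0 + p * p * (3 * j * j + v * j)"
      unfolding k0(1) by (simp add: algebra_simps)
    finally have "w ^ E (k0 + p * j) = w ^ E k0 * (w ^ (p * p)) ^ (3 * j * j + v * j)"
      by (simp only: power_add power_mult[of w "p * p"])
    moreover have "(-1 :: complex) ^ (k0 + p * j) = (-1) ^ k0 * (-1) ^ j"
      using oddp by (simp add: power_add minus_one_power_iff)
    ultimately show "of_nat p * c (k0 + p * j) =
        of_nat p * ((-1) ^ k0 * w ^ E k0) * ((-1) ^ j * (w ^ (p * p)) ^ (3 * j * j + v * j))"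
      by (simp add: c_def)
  qed
  finally have *: "(\<Sum>j<m. (-1) ^ j * (w ^ (p * p)) ^ (3 * j * j + v * j)) = 0"
    using w0 p(2) by auto
  show ?thesis
  proof (cases "v = 1")
    case True
    have "3 * j * j + 1 * j = j * (3 * j + 1)" for j :: nat
      by (simp add: algebra_simps)
    with * show ?thesis
      by (simp only: True pentagonal_sum_def)
  next
    case False
    \<comment> \<open>For \<open>v = 5\<close> the order of summation is reversed:
      \<open>j \<mapsto> -1 - j\<close> modulo \<open>m\<close> turns
      \<open>3 j\<^sup>2 + 5 j\<close> into \<open>j (3 j + 1) - 2\<close>, which costs only the
      factor \<open>W\<^sup>2\<close>.\<close>
    define W where "W = w ^ (p * p)"
    have W: "W ^ m = 1"
      unfolding W_def using w by (simp add: mult.assoc flip: power_mult)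
    have "pentagonal_sum m W = (\<Sum>j<m. W\<^sup>2 * ((-1) ^ j * W ^ (3 * j * j + v * j)))"
      unfolding pentagonal_sum_def
    proof (rule sum.reindex_bij_witness[where i = "\<lambda>j. m - 1 - j" and j = "\<lambda>j. m - 1 - j"])
      fix i assume i: "i \<in> {..<m}"
      define j where "j = m - 1 - i"
      have m': "m = i + j + 1"
        using i by (simp add: j_def)
      have "2 + (3 * j * j + 5 * j) + m * (3 * i + 1) = i * (3 * i + 1) + m * (3 * j + 3)"
        unfolding m' by (simp add: algebra_simps)
      then have "W ^ (2 + (3 * j * j + 5 * j) + m * (3 * i + 1)) = W ^ (i * (3 * i + 1) + m * (3 * j + 3))"
        by (simp only:)
      then have "W\<^sup>2 * W ^ (3 * j * j + 5 * j) = W ^ (i * (3 * i + 1))"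
        unfolding power_add[of W _ "m * _"] power_mult[of W m] W power_add[of W 2] by simp
      moreover have "(-1 :: complex) ^ j = (-1) ^ i"
        using m m' by (auto simp: minus_one_power_iff)
      ultimately show "W\<^sup>2 * ((-1) ^ (m - 1 - i) * W ^ (3 * (m - 1 - i) * (m - 1 - i) + v * (m - 1 - i))) =
          (-1) ^ i * W ^ (i * (3 * i + 1))"
        unfolding j_def[symmetric] using False k0(3) by (simp add: mult.left_commute)
    qed auto
    also have "\<dots> = 0"
      using * by (simp add: W_def flip: sum_distrib_left)
    finally show ?thesis
      by (simp add: W_def)
  qed
qed

lemma three_power_of_prime_factors:
  fixes n :: nat
  assumes "0 < n" "\<And>p. prime p \<Longrightarrow> p dvd n \<Longrightarrow> p = 3"
  obtains a where "n = 3 ^ a"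
proof -
  have "\<exists>a. n = 3 ^ a"
    using assms
  proof (induction n rule: less_induct)
    case (less n)
    show ?case
    proof (cases "n = 1")
      case True
      then show ?thesis
        by (intro exI[of _ 0]) simp
    next
      case False
      then obtain p where "prime p" "p dvd n"
        using prime_factor_nat by blast
      then have "3 dvd n"
        using less.prems(2) by blast
      then obtain m where m: "n = 3 * m"
        by (auto elim: dvdE)
      have "\<exists>a. m = 3 ^ a"
        using less.prems m by (intro less.IH) auto
      then show ?thesis
        unfolding m by (metis power_Suc)
    qed
  qed
  then show ?thesis
    using that by blast
qed

lemma primitive_root_power_divisor:
  assumes "primitive_root (d * m) s"
  shows "primitive_root m (s ^ d)"
proof -
  have "0 < d" "0 < m"
    using assms by (auto simp: primitive_root_def)
  moreover have "(s ^ d) ^ k = 1 \<longleftrightarrow> m dvd k" for k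
    using primitive_root_power_eq_1_iff[OF assms, of "d * k"] \<open>0 < d\<close> by (simp add: power_mult)
  ultimately show ?thesis
    by (auto simp: primitive_root_def dest: nat_dvd_not_less)
qed

lemma pentagonal_sum_nonzero:
  assumes "odd n" "primitive_root n s"
  shows "pentagonal_sum n s \<noteq> 0"
  using assms
proof (induction n arbitrary: s rule: less_induct)
  case (less n)
  show ?case
  proof
    assume zero: "pentagonal_sum n s = 0"
    have n0: "0 < n"
      using less.prems(2) by (simp add: primitive_root_def)
    show False
    proof (cases "\<exists>p. prime p \<and> p dvd n \<and> 5 \<le> p")
      case False
      have "p = 3" if "prime p" "p dvd n" for p
      proof -
        have "p < 5" "p \<noteq> 2" "2 \<le> p"
          using that False less.prems(1) prime_ge_2_nat by auto
        then have "p = 3 \<or> p = 4"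
          by auto
        then show ?thesis
          using \<open>odd n\<close> that(2) by auto
      qed
      then obtain a where "n = 3 ^ a"
        using three_power_of_prime_factors[OF n0] by blast
      then show False
        using pentagonal_sum_prime_power_nonzero[of 3 a s] less.prems(2) zero by simp
    next
      case True
      then obtain p where p: "prime p" "p dvd n" "5 \<le> p"
        by blast
      then obtain m where m: "n = p * m"
        by (auto elim: dvdE)
      have odd: "odd m" "odd p"
        using less.prems(1) m by auto
      have m0: "0 < m" "m < n"
        using n0 m p(3) by auto
      have \<eta>: "primitive_root p (s ^ m)"
        using primitive_root_power_divisor[of m p s] less.prems(2) by (simp add: m mult.commute)
      have sn: "s ^ (p * m) = 1"
        using less.prems(2) by (simp add: m primitive_root_def)
      show False
      proof (cases "p dvd m")
        case True
        then obtain m' where m': "m = p * m'"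
          by (auto elim: dvdE)
        \<comment> \<open>Since \<open>p\<close> divides \<open>m\<close>, the exponent
          \<open>m * a + 1\<close> is prime to \<open>n\<close> for every \<open>a\<close>, and
          \<open>w = s\<close> can be taken.\<close>
        have "pentagonal_sum (p * m) (s * (s ^ m) ^ a) = 0" for a
        proof -
          have "coprime (m * a + 1) m"
            by (metis coprime_1_left coprime_iff_gcd_eq_1 gcd_add_mult mult.commute add.commute gcd.commute)
          then have "coprime (m * a + 1) (p * m)"
            using m' by simp
          then have "pentagonal_sum (p * m) (s ^ (m * a + 1)) = 0"
            using pentagonal_sum_galois[of "p * m" s "m * a + 1"] less.prems(2) zero m by simp
          moreover have "s ^ (m * a + 1) = s * (s ^ m) ^ a"
            by (simp add: power_mult)
          ultimately show ?thesis
            by (simp only:)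
        qed
        moreover have "s ^ (p * (p * m)) = 1"
          using sn by (metis mult.commute power_mult power_one)
        ultimately have "pentagonal_sum m (s ^ (p * p)) = 0"
          by (intro pentagonal_sum_descent[OF p(1,3) \<eta>]) (use odd in auto)
        moreover have prim: "primitive_root m' (s ^ (p * p))"
          using primitive_root_power_divisor[of "p * p" m' s] less.prems(2) by (simp add: m m' mult.assoc)
        \<comment> \<open>The descent yields a sum of length \<open>m\<close> at a root of the
          smaller order \<open>m'\<close>, which is a sum over \<open>p\<close> periods.\<close>
        moreover have "pentagonal_sum m (s ^ (p * p)) = pentagonal_sum m' (s ^ (p * p))"
          unfolding m' using prim odd m' by (intro pentagonal_sum_collapse) (auto simp: primitive_root_def)
        moreover have "m' < n"
        proof -
          have "m' \<le> m"
            unfolding m' using p(3) by simp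
          then show ?thesis
            using m0(2) by simp
        qed
        ultimately show False
          using less.IH[of m' "s ^ (p * p)"] m0 m' odd by auto
      next
        case False
        then have cop: "coprime p m"
          using p(1) by (rule prime_imp_coprime[rotated])
        \<comment> \<open>Now \<open>p + m * a\<close> is prime to \<open>m\<close> because of its
          first summand and to \<open>p\<close> because of the second; the latter fails for
          \<open>a = 0\<close>.\<close>
        have "pentagonal_sum (p * m) (s ^ p * (s ^ m) ^ a) = 0" if "0 < a" "a < p" for a
        proof -
          have "coprime (p + m * a) m"
            using cop by (metis coprime_iff_gcd_eq_1 gcd_add_mult gcd.commute add.commute mult.commute)
          moreover have "coprime (p + m * a) p"
          proof -
            have "\<not> p dvd a"
              using that by (auto dest: dvd_imp_le)
            then have "\<not> p dvd m * a"
              using False p(1) by (simp add: prime_dvd_mult_iff)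
            then have "\<not> p dvd p + m * a"
              by simp
            then show ?thesis
              using p(1) by (metis prime_imp_coprime coprime_commute)
          qed
          ultimately have "coprime (p + m * a) (p * m)"
            by simp
          then have "pentagonal_sum (p * m) (s ^ (p + m * a)) = 0"
            using pentagonal_sum_galois[of "p * m" s "p + m * a"] less.prems(2) zero m p(3) by simp
          then show ?thesis
            by (simp add: power_mult power_add)
        qed
        moreover have "(s ^ p) ^ (p * (p * m)) = 1"
          using sn by (metis mult.commute power_mult power_one)
        ultimately have "pentagonal_sum m ((s ^ p) ^ (p * p)) = 0"
          by (intro pentagonal_sum_descent[OF p(1,3) \<eta>]) (use odd in auto)
        moreover have "primitive_root m ((s ^ p) ^ (p * p))"
          using primitive_root_power[of m "s ^ p" "p * p"] primitive_root_power_divisor[of p m s]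
            less.prems(2) cop by (simp add: m)
        ultimately show False
          using less.IH[of m] m0 odd by auto
      qed
    qed
  qed
qed

theorem theorem2p1:
  fixes n :: nat
  assumes "odd n" and "ereal (real n) > M1\<^sup>2"
  shows "\<forall>\<zeta>. primitive_root n \<zeta> \<longrightarrow>
           mock_phi \<zeta> \<noteq> 0 \<and> mock_mu \<zeta> \<noteq> 0 \<and> mock_sigma (-\<zeta>) \<noteq> 0"
proof (intro allI impI)
  fix \<zeta> assume \<zeta>: "primitive_root n \<zeta>"
  obtain h where h: "n = 2 * h + 1"
    using assms(1) by (auto elim: oddE)
  note inv = primitive_root_inverse[OF \<zeta>]
  obtain s where s: "primitive_root n s" "s\<^sup>2 = inverse \<zeta>"
    using primitive_root_sqrt[OF inv assms(1)] by blast
  have "mock_phi \<zeta> \<noteq> 0"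
    using mock_phi_eq_pentagonal_sum[of h \<zeta> s] pentagonal_sum_nonzero[OF assms(1) s(1)] \<zeta> s
    by (simp add: h)
  moreover have "mock_mu \<zeta> \<noteq> 0"
    using mock_mu_eq_pentagonal_sum[of h \<zeta>] pentagonal_sum_nonzero[OF assms(1) inv] \<zeta>
    by (auto simp: h)
  moreover have "mock_sigma (-\<zeta>) \<noteq> 0"
    using mock_sigma_eq_pentagonal_sum[OF assms(1) \<zeta>] pentagonal_sum_nonzero[OF assms(1) inv]
    by auto
  ultimately show "mock_phi \<zeta> \<noteq> 0 \<and> mock_mu \<zeta> \<noteq> 0 \<and> mock_sigma (-\<zeta>) \<noteq> 0"
    by blast
qed

end
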